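(* Let $F : \mathcal{C} \to \mathcal{E}$ be a functor such that $\mathcal{C}$ and $\mathcal{E}$ have subobject classifiers $\Omega_{\mathcal{C}}$ and $\Omega_{\mathcal{E}}$ respectively (with truth maps $\mathrm{true}$), $\mathcal{E}$ has all finite limits, and $F$ preserves finite limits. Let $$\Omega_{\mathrm{Gl}(F)} \overset{i}{\hookrightarrow} \Omega_{\mathcal{E}} \times F\Omega_{\mathcal{C}}$$ be the equaliser of $\pi_1$ and $\wedge \circ (\mathrm{id} \times \chi_{F(\mathrm{true})}) : \Omega_{\mathcal{E}} \times F\Omega_{\mathcal{C}} \rightrightarrows \Omega_{\mathcal{E}}$, and let $\mathrm{true}_{\mathrm{Gl}(F)} : 1 \to \Omega_{\mathrm{Gl}(F)}$ be the map induced by $(1 \xrightarrow{\mathrm{true}} \Omega_{\mathcal{E}},\ 1 \cong F1 \xrightarrow{F(\mathrm{true})} F\Omega_{\mathcal{C}})$. Then the Artin gluing category $\mathrm{Gl}(F)$ has a subobject classifier and truth map, as follows. The subobject classifier is the object $$\Omega_{\mathrm{Gl}(F)} \overset{i}{\hookrightarrow} \Omega_{\mathcal{E}} \times F\Omega_{\mathcal{C}} \xrightarrow{\pi_2} F\Omega_{\mathcal{C}}$$ of $\mathrm{Gl}(F)$, and the truth map is the map $(\mathrm{true}_{\mathrm{Gl}(F)}, \mathrm{true})$ in $\mathrm{Gl}(F)$ from the object $1 \cong F1$ to it. Given a monomorphism $(g, k)$ in $\mathrm{Gl}(F)$, with $g : b \hookrightarrow a$ in $\mathcal{E}$ and $k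 : y \hookrightarrow x$ in $\mathcal{C}$, from $\beta : b \to Fy$ to $\alpha : a \to Fx$, its characteristic map is the pair $(\chi_\beta, \chi_k)$, where $\chi_k : x \to \Omega_{\mathcal{C}}$ is the characteristic map of $k$ and $\chi_\beta : a \to \Omega_{\mathrm{Gl}(F)}$ is the unique map with $i \circ \chi_\beta = (\chi_g, F\chi_k \circ \alpha)$, with $\chi_g : a \to \Omega_{\mathcal{E}}$ the characteristic map of $g$.
   Context: The *Artin gluing category* $\mathrm{Gl}(F)$ of a functor $F : \mathcal{C} \to \mathcal{E}$ is the comma category $\mathcal{E} \downarrow F$: objects are maps $\alpha : a \to Fx$ in $\mathcal{E}$ with $a \in \mathcal{E}$, $x \in \mathcal{C}$; a map from $\beta : b \to Fy$ to $\alpha : a \to Fx$ is a pair $(g : b \to a \text{ in } \mathcal{E},\ k : y \to x \text{ in } \mathcal{C})$ with $\alpha \circ g = Fk \circ \beta$. For a category with subobject classifier $\Omega$ and truth map $\mathrm{true} : 1 \to \Omega$, the characteristic map $\chi_m$ of a mono $m$ is the unique map into $\Omega$ along which the pullback of $\mathrm{true}$ is $m$. $\wedge : \Omega_{\mathcal{E}} \times \Omega_{\mathcal{E}} \to \Omega_{\mathcal{E}}$ is the internal meet, i.e. the characteristic map of $(\mathrm{true}, \mathrm{true}) : 1 \to \Omega_{\mathcal{E}} \times \Omega_{\mathcal{E}}$. $\chi_{F(\mathrm{true})} : F\Omega_{\mathcal{C}} \to \Omega_{\mathcal{E}}$ is the characteristic map of the mono $F(\mathrm{true}) : F1 \hookrightarrow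 F\Omega_{\mathcal{C}}$. $\pi_1, \pi_2$ denote product projections. *)

theory Defs
  imports Main
begin

section \<open>Categories and functors\<close>

text \<open>A category is given by carrier sets of objects and of arrows; \<open>g \<cdot>\<^bsub>C\<^esub> f\<close> is the composite
  ``\<open>g\<close> after \<open>f\<close>'', and is only meaningful if \<open>Dom C g = Cod C f\<close>.\<close>

record ('o, 'a) cat =
  Obj :: "'o set"
  Arr :: "'a set"
  Dom :: "'a \<Rightarrow> 'o"
  Cod :: "'a \<Rightarrow> 'o"
  Ident :: "'o \<Rightarrow> 'a"
  Comp :: "'a \<Rightarrow> 'a \<Rightarrow> 'a"  (infixr "\<cdot>\<index>" 70)

definition Hom :: "('o, 'a) cat \<Rightarrow> 'o \<Rightarrow> 'o \<Rightarrow> 'a set" where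
  "Hom C x y = {f \<in> Arr C. Dom C f = x \<and> Cod C f = y}"

locale category =
  fixes C :: "('o, 'a) cat" (structure)
  assumes Dom_in: "f \<in> Arr C \<Longrightarrow> Dom C f \<in> Obj C"
    and Cod_in: "f \<in> Arr C \<Longrightarrow> Cod C f \<in> Obj C"
    and Ident_in: "x \<in> Obj C \<Longrightarrow> Ident C x \<in> Hom C x x"
    and Comp_in: "\<lbrakk>f \<in> Hom C x y; g \<in> Hom C y z\<rbrakk> \<Longrightarrow> g \<cdot> f \<in> Hom C x z"
    and Comp_Ident: "f \<in> Hom C x y \<Longrightarrow> f \<cdot> Ident C x = f"
    and Ident_Comp: "f \<in> Hom C x y \<Longrightarrow> Ident C y \<cdot> f = f"
    and Comp_assoc: "\<lbrakk>f \<in> Hom C w x; g \<in> Hom C x y; h \<in> Hom C y z\<rbrakk>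
      \<Longrightarrow> (h \<cdot> g) \<cdot> f = h \<cdot> (g \<cdot> f)"

record ('o, 'a, 'p, 'b) cfunctor =
  FObj :: "'o \<Rightarrow> 'p"
  FArr :: "'a \<Rightarrow> 'b"

locale is_functor =
  source: category C + target: category D
  for C :: "('o, 'a) cat" and D :: "('p, 'b) cat" and F :: "('o, 'a, 'p, 'b) cfunctor" +
  assumes FObj_in: "x \<in> Obj C \<Longrightarrow> FObj F x \<in> Obj D"
    and FArr_in: "f \<in> Hom C x y \<Longrightarrow> FArr F f \<in> Hom D (FObj F x) (FObj F y)"
    and FArr_Ident: "x \<in> Obj C \<Longrightarrow> FArr F (Ident C x) = Ident D (FObj F x)"
    and FArr_Comp: "\<lbrakk>f \<in> Hom C x y; g \<in> Hom C y z\<rbrakk>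
      \<Longrightarrow> FArr F (g \<cdot>\<^bsub>C\<^esub> f) = FArr F g \<cdot>\<^bsub>D\<^esub> FArr F f"

definition functor_comp ::
    "('p, 'b, 'q, 'c) cfunctor \<Rightarrow> ('o, 'a, 'p, 'b) cfunctor \<Rightarrow> ('o, 'a, 'q, 'c) cfunctor" where
  "functor_comp G F = \<lparr>FObj = FObj G \<circ> FObj F, FArr = FArr G \<circ> FArr F\<rparr>"

definition monic :: "('o, 'a) cat \<Rightarrow> 'a \<Rightarrow> bool" where
  "monic C m \<longleftrightarrow> m \<in> Arr C \<and>
    (\<forall>z u v. u \<in> Hom C z (Dom C m) \<and> v \<in> Hom C z (Dom C m) \<and> m \<cdot>\<^bsub>C\<^esub> u = m \<cdot>\<^bsub>C\<^esub> v \<longrightarrow> u = v)"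

definition iso :: "('o, 'a) cat \<Rightarrow> 'a \<Rightarrow> bool" where
  "iso C f \<longleftrightarrow> f \<in> Arr C \<and>
    (\<exists>g \<in> Hom C (Cod C f) (Dom C f).
      g \<cdot>\<^bsub>C\<^esub> f = Ident C (Dom C f) \<and> f \<cdot>\<^bsub>C\<^esub> g = Ident C (Cod C f))"

section \<open>Limits\<close>

definition is_cone ::
    "('i, 'j) cat \<Rightarrow> ('o, 'a) cat \<Rightarrow> ('i, 'j, 'o, 'a) cfunctor \<Rightarrow> 'o \<Rightarrow> ('i \<Rightarrow> 'a) \<Rightarrow> bool" where
  "is_cone J C D L l \<longleftrightarrow> L \<in> Obj C \<and>
    (\<forall>j \<in> Obj J. l j \<in> Hom C L (FObj D j)) \<and>
    (\<forall>u \<in> Arr J. FArr D u \<cdot>\<^bsub>C\<^esub> l (Dom J u) = l (Cod J u))"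

definition is_limit ::
    "('i, 'j) cat \<Rightarrow> ('o, 'a) cat \<Rightarrow> ('i, 'j, 'o, 'a) cfunctor \<Rightarrow> 'o \<Rightarrow> ('i \<Rightarrow> 'a) \<Rightarrow> bool" where
  "is_limit J C D L l \<longleftrightarrow> is_cone J C D L l \<and>
    (\<forall>M m. is_cone J C D M m \<longrightarrow>
      (\<exists>!h. h \<in> Hom C M L \<and> (\<forall>j \<in> Obj J. l j \<cdot>\<^bsub>C\<^esub> h = m j)))"

text \<open>Every finite category is isomorphic to one whose objects and arrows are natural numbers, so
  such shapes suffice to speak about all finite limits.\<close>

definition finite_shape :: "(nat, nat) cat \<Rightarrow> bool" where
  "finite_shape J \<longleftrightarrow> category J \<and> finite (Obj J) \<and> finite (Arr J)"

definition has_finite_limits :: "('o, 'a) cat \<Rightarrow> bool" where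
  "has_finite_limits C \<longleftrightarrow>
    (\<forall>J D. finite_shape J \<and> is_functor J C D \<longrightarrow> (\<exists>L l. is_limit J C D L l))"

text \<open>The source need not have all finite limits; those that exist in it are to be preserved.\<close>

definition preserves_finite_limits ::
    "('o, 'a) cat \<Rightarrow> ('p, 'b) cat \<Rightarrow> ('o, 'a, 'p, 'b) cfunctor \<Rightarrow> bool" where
  "preserves_finite_limits C E F \<longleftrightarrow>
    (\<forall>J D L l. finite_shape J \<and> is_functor J C D \<and> is_limit J C D L l
      \<longrightarrow> is_limit J E (functor_comp F D) (FObj F L) (\<lambda>j. FArr F (l j)))"

definition is_terminal :: "('o, 'a) cat \<Rightarrow> 'o \<Rightarrow> bool" where
  "is_terminal C t \<longleftrightarrow> t \<in> Obj C \<and> (\<forall>x \<in> Obj C. \<exists>!f. f \<in> Hom C x t)"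

definition to_terminal :: "('o, 'a) cat \<Rightarrow> 'o \<Rightarrow> 'o \<Rightarrow> 'a" where
  "to_terminal C t x = (THE f. f \<in> Hom C x t)"

definition is_product :: "('o, 'a) cat \<Rightarrow> 'o \<Rightarrow> 'o \<Rightarrow> 'o \<Rightarrow> 'a \<Rightarrow> 'a \<Rightarrow> bool" where
  "is_product C x y P p q \<longleftrightarrow> p \<in> Hom C P x \<and> q \<in> Hom C P y \<and>
    (\<forall>z. \<forall>f \<in> Hom C z x. \<forall>g \<in> Hom C z y.
      \<exists>!h. h \<in> Hom C z P \<and> p \<cdot>\<^bsub>C\<^esub> h = f \<and> q \<cdot>\<^bsub>C\<^esub> h = g)"

text \<open>The map \<open>(f, g)\<close> into the product with projections \<open>p\<close> and \<open>q\<close>.\<close>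

definition pairing :: "('o, 'a) cat \<Rightarrow> 'a \<Rightarrow> 'a \<Rightarrow> 'a \<Rightarrow> 'a \<Rightarrow> 'a" where
  "pairing C p q f g =
    (THE h. h \<in> Hom C (Dom C f) (Dom C p) \<and> p \<cdot>\<^bsub>C\<^esub> h = f \<and> q \<cdot>\<^bsub>C\<^esub> h = g)"

text \<open>The map \<open>f \<times> g\<close> from the product with projections \<open>p\<close> and \<open>q\<close> to the product with
  projections \<open>p'\<close> and \<open>q'\<close>.\<close>

definition prod_map :: "('o, 'a) cat \<Rightarrow> 'a \<Rightarrow> 'a \<Rightarrow> 'a \<Rightarrow> 'a \<Rightarrow> 'a \<Rightarrow> 'a \<Rightarrow> 'a" where
  "prod_map C p q p' q' f g = pairing C p' q' (f \<cdot>\<^bsub>C\<^esub> p) (g \<cdot>\<^bsub>C\<^esub> q)"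

definition is_equaliser :: "('o, 'a) cat \<Rightarrow> 'a \<Rightarrow> 'a \<Rightarrow> 'a \<Rightarrow> bool" where
  "is_equaliser C f g e \<longleftrightarrow> f \<in> Arr C \<and> g \<in> Hom C (Dom C f) (Cod C f) \<and>
    e \<in> Arr C \<and> Cod C e = Dom C f \<and> f \<cdot>\<^bsub>C\<^esub> e = g \<cdot>\<^bsub>C\<^esub> e \<and>
    (\<forall>z. \<forall>h \<in> Hom C z (Dom C f). f \<cdot>\<^bsub>C\<^esub> h = g \<cdot>\<^bsub>C\<^esub> h \<longrightarrow>
      (\<exists>!u. u \<in> Hom C z (Dom C e) \<and> e \<cdot>\<^bsub>C\<^esub> u = h))"

text \<open>The map that \<open>h\<close> induces into the domain of \<open>e\<close>, for \<open>h\<close> factoring uniquely through \<open>e\<close>.\<close>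

definition induced :: "('o, 'a) cat \<Rightarrow> 'a \<Rightarrow> 'a \<Rightarrow> 'a" where
  "induced C e h = (THE u. u \<in> Hom C (Dom C h) (Dom C e) \<and> e \<cdot>\<^bsub>C\<^esub> u = h)"

text \<open>\<open>p\<close> and \<open>q\<close> are the legs, over \<open>f\<close> and \<open>g\<close> respectively, of a pullback of \<open>f\<close> and \<open>g\<close>.\<close>

definition is_pullback :: "('o, 'a) cat \<Rightarrow> 'a \<Rightarrow> 'a \<Rightarrow> 'a \<Rightarrow> 'a \<Rightarrow> bool" where
  "is_pullback C f g p q \<longleftrightarrow> f \<in> Arr C \<and> g \<in> Arr C \<and> Cod C f = Cod C g \<and>
    p \<in> Arr C \<and> q \<in> Arr C \<and> Dom C p = Dom C q \<and> Cod C p = Dom C f \<and> Cod C q = Dom C g \<and>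
    f \<cdot>\<^bsub>C\<^esub> p = g \<cdot>\<^bsub>C\<^esub> q \<and>
    (\<forall>z. \<forall>u \<in> Hom C z (Dom C f). \<forall>v \<in> Hom C z (Dom C g). f \<cdot>\<^bsub>C\<^esub> u = g \<cdot>\<^bsub>C\<^esub> v \<longrightarrow>
      (\<exists>!h. h \<in> Hom C z (Dom C p) \<and> p \<cdot>\<^bsub>C\<^esub> h = u \<and> q \<cdot>\<^bsub>C\<^esub> h = v))"

section \<open>Subobject classifiers\<close>

text \<open>Throughout, \<open>t\<close> is the terminal object and \<open>tr : t \<rightarrow> \<Omega>\<close> the truth map.\<close>

definition classifies :: "('o, 'a) cat \<Rightarrow> 'o \<Rightarrow> 'a \<Rightarrow> 'a \<Rightarrow> 'a \<Rightarrow> bool" where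
  "classifies C t tr m c \<longleftrightarrow>
    c \<in> Hom C (Cod C m) (Cod C tr) \<and> is_pullback C c tr m (to_terminal C t (Dom C m))"

definition subobject_classifier :: "('o, 'a) cat \<Rightarrow> 'o \<Rightarrow> 'o \<Rightarrow> 'a \<Rightarrow> bool" where
  "subobject_classifier C t \<Omega> tr \<longleftrightarrow> is_terminal C t \<and> tr \<in> Hom C t \<Omega> \<and>
    (\<forall>m. monic C m \<longrightarrow> (\<exists>!c. classifies C t tr m c))"

definition char_map :: "('o, 'a) cat \<Rightarrow> 'o \<Rightarrow> 'a \<Rightarrow> 'a \<Rightarrow> 'a" where
  "char_map C t tr m = (THE c. classifies C t tr m c)"

text \<open>The internal meet, with \<open>q1\<close> and \<open>q2\<close> the projections of \<open>\<Omega> \<times> \<Omega>\<close>.\<close>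

definition meet :: "('o, 'a) cat \<Rightarrow> 'o \<Rightarrow> 'a \<Rightarrow> 'a \<Rightarrow> 'a \<Rightarrow> 'a" where
  "meet C t tr q1 q2 = char_map C t tr (pairing C q1 q2 tr tr)"

section \<open>Artin gluing\<close>

text \<open>\<open>GObj a \<alpha> x\<close> is the object \<open>\<alpha> : a \<rightarrow> F x\<close>. An arrow \<open>(g, k)\<close> from \<open>\<beta>\<close> to \<open>\<alpha>\<close> is encoded as
  \<open>GArr \<beta> \<alpha> g k\<close>, since \<open>g\<close> and \<open>k\<close> do not determine \<open>\<beta>\<close> and \<open>\<alpha>\<close>.\<close>

datatype ('p, 'b, 'o) gobj = GObj (gtop: 'p) (gstr: 'b) (gbase: 'o)

datatype ('p, 'b, 'o, 'a) garr =
  GArr (gsrc: "('p, 'b, 'o) gobj") (gtgt: "('p, 'b, 'o) gobj") (atop: 'b) (abase: 'a)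

definition gluing :: "('o, 'a) cat \<Rightarrow> ('p, 'b) cat \<Rightarrow> ('o, 'a, 'p, 'b) cfunctor
    \<Rightarrow> (('p, 'b, 'o) gobj, ('p, 'b, 'o, 'a) garr) cat" where
  "gluing C E F =
    (let Ob = {GObj a \<alpha> x | a \<alpha> x. a \<in> Obj E \<and> x \<in> Obj C \<and> \<alpha> \<in> Hom E a (FObj F x)} in
    \<lparr>Obj = Ob,
     Arr = {GArr B A g k | B A g k. B \<in> Ob \<and> A \<in> Ob \<and>
       g \<in> Hom E (gtop B) (gtop A) \<and> k \<in> Hom C (gbase B) (gbase A) \<and>
       gstr A \<cdot>\<^bsub>E\<^esub> g = FArr F k \<cdot>\<^bsub>E\<^esub> gstr B},
     Dom = gsrc,
     Cod = gtgt,
     Ident = (\<lambda>A. GArr A A (Ident E (gtop A)) (Ident C (gbase A))),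
     Comp = (\<lambda>n m. GArr (gsrc m) (gtgt n) (atop n \<cdot>\<^bsub>E\<^esub> atop m) (abase n \<cdot>\<^bsub>C\<^esub> abase m))\<rparr>)"

lemma gluing_simps:
  "Obj (gluing C E F) =
    {GObj a \<alpha> x | a \<alpha> x. a \<in> Obj E \<and> x \<in> Obj C \<and> \<alpha> \<in> Hom E a (FObj F x)}"
  "Dom (gluing C E F) = gsrc"
  "Cod (gluing C E F) = gtgt"
  "Ident (gluing C E F) A = GArr A A (Ident E (gtop A)) (Ident C (gbase A))"
  "n \<cdot>\<^bsub>gluing C E F\<^esub> m =
    GArr (gsrc m) (gtgt n) (atop n \<cdot>\<^bsub>E\<^esub> atop m) (abase n \<cdot>\<^bsub>C\<^esub> abase m)"
  by (simp_all add: gluing_def Let_def)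

lemma Obj_gluing_iff:
  "A \<in> Obj (gluing C E F) \<longleftrightarrow>
    gtop A \<in> Obj E \<and> gbase A \<in> Obj C \<and> gstr A \<in> Hom E (gtop A) (FObj F (gbase A))"
  unfolding gluing_simps by (cases A) auto

lemma Hom_gluing_iff:
  "m \<in> Hom (gluing C E F) B A \<longleftrightarrow>
    B \<in> Obj (gluing C E F) \<and> A \<in> Obj (gluing C E F) \<and> gsrc m = B \<and> gtgt m = A \<and>
    atop m \<in> Hom E (gtop B) (gtop A) \<and> abase m \<in> Hom C (gbase B) (gbase A) \<and>
    gstr A \<cdot>\<^bsub>E\<^esub> atop m = FArr F (abase m) \<cdot>\<^bsub>E\<^esub> gstr B"
  unfolding Hom_def[of "gluing C E F"] by (cases m) (auto simp: gluing_def Let_def)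

lemma gluing_category:
  assumes "is_functor C E F"
  shows "category (gluing C E F)"
proof -
  interpret is_functor C E F by fact
  have hom: "m \<in> Hom (gluing C E F) (gsrc m) (gtgt m)" if "m \<in> Arr (gluing C E F)" for m
    using that by (simp add: Hom_def gluing_simps)
  show ?thesis
  proof
    fix m assume "m \<in> Arr (gluing C E F)"
    then show "Dom (gluing C E F) m \<in> Obj (gluing C E F)" "Cod (gluing C E F) m \<in> Obj (gluing C E F)"
      using hom unfolding Hom_gluing_iff gluing_simps(2,3) by blast+
  next
    fix A assume A: "A \<in> Obj (gluing C E F)"
    then have "gstr A \<cdot>\<^bsub>E\<^esub> Ident E (gtop A) = FArr F (Ident C (gbase A)) \<cdot>\<^bsub>E\<^esub> gstr A"
      unfolding Obj_gluing_iff by (metis FArr_Ident target.Comp_Ident target.Ident_Comp)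
    with A show "Ident (gluing C E F) A \<in> Hom (gluing C E F) A A"
      by (simp add: Hom_gluing_iff gluing_simps(4) Obj_gluing_iff source.Ident_in target.Ident_in)
  next
    fix f X Y g Z
    assume f: "f \<in> Hom (gluing C E F) X Y" and g: "g \<in> Hom (gluing C E F) Y Z"
    have t: "atop f \<in> Hom E (gtop X) (gtop Y)" "atop g \<in> Hom E (gtop Y) (gtop Z)"
      "abase f \<in> Hom C (gbase X) (gbase Y)" "abase g \<in> Hom C (gbase Y) (gbase Z)"
      "gstr X \<in> Hom E (gtop X) (FObj F (gbase X))" "gstr Y \<in> Hom E (gtop Y) (FObj F (gbase Y))"
      "gstr Z \<in> Hom E (gtop Z) (FObj F (gbase Z))"
      and e: "gstr Y \<cdot>\<^bsub>E\<^esub> atop f = FArr F (abase f) \<cdot>\<^bsub>E\<^esub> gstr X"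
      "gstr Z \<cdot>\<^bsub>E\<^esub> atop g = FArr F (abase g) \<cdot>\<^bsub>E\<^esub> gstr Y"
      using f g unfolding Hom_gluing_iff Obj_gluing_iff by blast+
    have "gstr Z \<cdot>\<^bsub>E\<^esub> (atop g \<cdot>\<^bsub>E\<^esub> atop f) = FArr F (abase g) \<cdot>\<^bsub>E\<^esub> (gstr Y \<cdot>\<^bsub>E\<^esub> atop f)"
      using target.Comp_assoc[OF t(1,2,7)] target.Comp_assoc[OF t(1,6) FArr_in[OF t(4)]]
      by (simp add: e(2))
    also have "\<dots> = FArr F (abase g \<cdot>\<^bsub>C\<^esub> abase f) \<cdot>\<^bsub>E\<^esub> gstr X"
      using target.Comp_assoc[OF t(5) FArr_in[OF t(3)] FArr_in[OF t(4)]] FArr_Comp[OF t(3,4)]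
      by (simp add: e(1))
    finally show "g \<cdot>\<^bsub>gluing C E F\<^esub> f \<in> Hom (gluing C E F) X Z"
      using f g target.Comp_in[OF t(1,2)] source.Comp_in[OF t(3,4)]
      by (simp add: Hom_gluing_iff gluing_simps(5))
  next
    fix f X Y assume f: "f \<in> Hom (gluing C E F) X Y"
    then have "atop f \<in> Hom E (gtop X) (gtop Y)" "abase f \<in> Hom C (gbase X) (gbase Y)"
      "gsrc f = X" "gtgt f = Y"
      unfolding Hom_gluing_iff by blast+
    then show "f \<cdot>\<^bsub>gluing C E F\<^esub> Ident (gluing C E F) X = f"
      "Ident (gluing C E F) Y \<cdot>\<^bsub>gluing C E F\<^esub> f = f"
      by (simp_all add: gluing_simps(4,5) garr.expand target.Comp_Ident source.Comp_Ident
          target.Ident_Comp source.Ident_Comp)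
  next
    fix f W X g Y h Z
    assume fgh: "f \<in> Hom (gluing C E F) W X" "g \<in> Hom (gluing C E F) X Y"
      "h \<in> Hom (gluing C E F) Y Z"
    then have "atop f \<in> Hom E (gtop W) (gtop X)" "abase f \<in> Hom C (gbase W) (gbase X)"
      "atop g \<in> Hom E (gtop X) (gtop Y)" "abase g \<in> Hom C (gbase X) (gbase Y)"
      "atop h \<in> Hom E (gtop Y) (gtop Z)" "abase h \<in> Hom C (gbase Y) (gbase Z)"
      unfolding Hom_gluing_iff by blast+
    then show "(h \<cdot>\<^bsub>gluing C E F\<^esub> g) \<cdot>\<^bsub>gluing C E F\<^esub> f
        = h \<cdot>\<^bsub>gluing C E F\<^esub> (g \<cdot>\<^bsub>gluing C E F\<^esub> f)"
      by (simp add: gluing_simps(5) source.Comp_assoc target.Comp_assoc)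
  qed
qed

end

(* A map c classifies a mono m iff, for every generalised element u, c is true at u exactly when
   u factors through m. A map into the gluing's Omega over d is an f : a -> Omega_E contained in the
   subobject of a on which F d after alpha is true; it is true at (u, v) iff f is true at u and d is
   true at v. For a mono (g, k) the square says that g lies in the pullback of F k along alpha, so
   (chi_g, chi_k) is such a map. Conversely, the components of any classifying map are chi_g and
   chi_k: each generalised element of a or of x on which they are true extends, after passing to
   the vertex of a suitable cone in E, to a generalised element (u, v) in the gluing. That g and k
   are monos is shown in the same way. *)

theory Submission
  imports Defs
begin

section \<open>Universal properties in a category\<close>

text \<open>No finite limits are assumed in \<open>C\<close>, so auxiliary objects cannot be built
  there. Three limits exist in \<open>C\<close> nonetheless and suffice: the terminal object, the
  pullback square of a characteristic map, and the square of identities that presents a mono as its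
  own kernel pair; \<open>F\<close> carries them to \<open>E\<close>. Any map of \<open>E\<close>
  into \<open>FObj F w\<close> is an object of the gluing over \<open>w\<close>, so test objects can
  be made from data in \<open>E\<close>. The obstacle is that a map of \<open>C\<close> into the
  base of an object \<open>A\<close> is no generalised element of \<open>A\<close> until it is given
  a compatible top component. An initial top would supply one, but \<open>E\<close> need not have an
  initial object. The vertex of a cone in \<open>E\<close> serves just as well, since equality or
  factorisation of base components can be read off whatever that vertex is. Conversely, a map into a
  top is completed over the base of the domain of the mono, with a map into the image of that base
  under \<open>F\<close> as structure map.\<close>

context category
begin

lemma Hom_Obj:
  assumes "f \<in> Hom C x y"
  shows "x \<in> Obj C" "y \<in> Obj C"
  using assms Dom_in Cod_in by (auto simp: Hom_def)

lemma monicI: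
  assumes "m \<in> Hom C b a"
    and "\<And>z u v. u \<in> Hom C z b \<Longrightarrow> v \<in> Hom C z b \<Longrightarrow> m \<cdot> u = m \<cdot> v \<Longrightarrow> u = v"
  shows "monic C m"
  using assms by (auto simp: monic_def Hom_def)

lemma monicD:
  assumes "monic C m" "m \<in> Hom C b a" "u \<in> Hom C z b" "v \<in> Hom C z b" "m \<cdot> u = m \<cdot> v"
  shows "u = v"
  using assms by (auto simp: monic_def Hom_def)

lemma to_terminal_in:
  assumes "is_terminal C t" "x \<in> Obj C"
  shows "to_terminal C t x \<in> Hom C x t"
  unfolding to_terminal_def by (rule theI') (use assms in \<open>simp add: is_terminal_def\<close>)

lemma terminal_eq:
  assumes "is_terminal C t" "f \<in> Hom C x t" "g \<in> Hom C x t"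
  shows "f = g"
  using assms Hom_Obj(1)[OF assms(2)] unfolding is_terminal_def by blast

lemma to_terminal_comp:
  assumes "is_terminal C t" "u \<in> Hom C z x"
  shows "to_terminal C t x \<cdot> u = to_terminal C t z"
  using terminal_eq[OF assms(1) Comp_in[OF assms(2) to_terminal_in[OF assms(1)]] to_terminal_in[OF assms(1)]]
    Hom_Obj[OF assms(2)]
  by simp

lemma monic_from_terminal:
  assumes "is_terminal C t" "m \<in> Hom C t a"
  shows "monic C m"
  by (rule monicI[OF assms(2)]) (rule terminal_eq[OF assms(1)])

lemma iso_terminal:
  assumes "is_terminal C t" "is_terminal C t'"
  shows "iso C (to_terminal C t' t)"
proof -
  have t: "t \<in> Obj C" "t' \<in> Obj C"
    using assms by (auto simp: is_terminal_def)
  have h: "to_terminal C t' t \<in> Hom C t t'" "to_terminal C t t' \<in> Hom C t' t"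
    using assms t to_terminal_in by auto
  have "to_terminal C t t' \<cdot> to_terminal C t' t = Ident C t"
    "to_terminal C t' t \<cdot> to_terminal C t t' = Ident C t'"
    using terminal_eq[OF assms(1) Comp_in[OF h(1,2)] Ident_in[OF t(1)]]
      terminal_eq[OF assms(2) Comp_in[OF h(2,1)] Ident_in[OF t(2)]] .
  then show ?thesis
    using h unfolding iso_def Hom_def by auto
qed

lemma pairing_props:
  assumes "is_product C x y P p q" "f \<in> Hom C z x" "g \<in> Hom C z y"
  shows "pairing C p q f g \<in> Hom C z P"
    and "p \<cdot> pairing C p q f g = f"
    and "q \<cdot> pairing C p q f g = g"
proof -
  \<comment> \<open>\<open>pairing\<close> takes no objects as arguments: it reads the stage off
    \<open>f\<close> and the vertex off \<open>p\<close>, so both must be identified before the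
    universal property applies to its description.\<close>
  have "Dom C f = z" "Dom C p = P"
    using assms by (auto simp: is_product_def Hom_def)
  moreover have "\<exists>!h. h \<in> Hom C z P \<and> p \<cdot> h = f \<and> q \<cdot> h = g"
    using assms unfolding is_product_def by blast
  from theI'[OF this] calculation
  have "pairing C p q f g \<in> Hom C z P \<and> p \<cdot> pairing C p q f g = f
      \<and> q \<cdot> pairing C p q f g = g"
    unfolding pairing_def by simp
  then show "pairing C p q f g \<in> Hom C z P" "p \<cdot> pairing C p q f g = f"
    "q \<cdot> pairing C p q f g = g"
    by auto
qed

lemma product_eqI:
  assumes P: "is_product C x y P p q" and h: "h \<in> Hom C z P" "h' \<in> Hom C z P"
    and e: "p \<cdot> h = p \<cdot> h'" "q \<cdot> h = q \<cdot> h'"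
  shows "h = h'"
proof -
  have pq: "p \<in> Hom C P x" "q \<in> Hom C P y"
    using P by (auto simp: is_product_def)
  have "p \<cdot> h' \<in> Hom C z x" "q \<cdot> h' \<in> Hom C z y"
    using Comp_in h(2) pq by blast+
  then have "\<exists>!l. l \<in> Hom C z P \<and> p \<cdot> l = p \<cdot> h' \<and> q \<cdot> l = q \<cdot> h'"
    using P unfolding is_product_def by blast
  then show ?thesis
    using h e by blast
qed

lemma pairing_comp:
  assumes P: "is_product C x y P p q" and f: "f \<in> Hom C z x" and g: "g \<in> Hom C z y"
    and u: "u \<in> Hom C w z"
  shows "pairing C p q f g \<cdot> u = pairing C p q (f \<cdot> u) (g \<cdot> u)"
proof -
  have pq: "p \<in> Hom C P x" "q \<in> Hom C P y"
    using P by (auto simp: is_product_def)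
  note h = pairing_props[OF P f g] and h' = pairing_props[OF P Comp_in[OF u f] Comp_in[OF u g]]
  show ?thesis
    using product_eqI[OF P Comp_in[OF u h(1)] h'(1)]
      Comp_assoc[OF u h(1) pq(1)] Comp_assoc[OF u h(1) pq(2)]
    by (simp add: h h')
qed

text \<open>The map \<open>e\<close> after \<open>v\<close> equalises \<open>f\<close> and
  \<open>g\<close>, and both \<open>u\<close> and \<open>v\<close> factor it through
  \<open>e\<close>, so uniqueness of the factorisation applies.\<close>

lemma equaliser_eqI:
  assumes e: "is_equaliser C f g e" and uv: "u \<in> Hom C z (Dom C e)" "v \<in> Hom C z (Dom C e)"
    and eq: "e \<cdot> u = e \<cdot> v"
  shows "u = v"
proof -
  have h: "e \<in> Hom C (Dom C e) (Dom C f)" "f \<in> Hom C (Dom C f) (Cod C f)"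
    "g \<in> Hom C (Dom C f) (Cod C f)" "f \<cdot> e = g \<cdot> e"
    using e by (auto simp: is_equaliser_def Hom_def)
  have "f \<cdot> (e \<cdot> v) = g \<cdot> (e \<cdot> v)"
    using Comp_assoc[OF uv(2) h(1) h(2)] Comp_assoc[OF uv(2) h(1) h(3)] h(4) by simp
  moreover have "e \<cdot> v \<in> Hom C z (Dom C f)"
    using Comp_in[OF uv(2) h(1)] .
  ultimately have "\<exists>!w. w \<in> Hom C z (Dom C e) \<and> e \<cdot> w = e \<cdot> v"
    using e unfolding is_equaliser_def by blast
  then show ?thesis
    using uv eq by blast
qed

lemma equaliser_factor:
  assumes "is_equaliser C f g e" "h \<in> Hom C z (Dom C f)" "f \<cdot> h = g \<cdot> h"
  shows "\<exists>!u. u \<in> Hom C z (Dom C e) \<and> e \<cdot> u = h"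
    and "induced C e h \<in> Hom C z (Dom C e)"
    and "e \<cdot> induced C e h = h"
proof -
  show *: "\<exists>!u. u \<in> Hom C z (Dom C e) \<and> e \<cdot> u = h"
    using assms unfolding is_equaliser_def by blast
  have "Dom C h = z"
    using assms(2) by (simp add: Hom_def)
  then have "induced C e h \<in> Hom C z (Dom C e) \<and> e \<cdot> induced C e h = h"
    using theI'[OF *] unfolding induced_def by simp
  then show "induced C e h \<in> Hom C z (Dom C e)" "e \<cdot> induced C e h = h"
    by auto
qed

text \<open>Together with its converse below, this turns monicity into a limit condition, which a
  functor preserving pullbacks respects. The legs are identities, so the kernel pair of a mono
  exists in any category.\<close>

lemma monic_imp_kernel_pair:
  assumes "monic C m" "m \<in> Hom C b a"
  shows "is_pullback C m m (Ident C b) (Ident C b)"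
proof -
  have b: "Ident C b \<in> Hom C b b" "m \<in> Arr C" "Dom C m = b"
    using assms Hom_Obj Ident_in by (auto simp: Hom_def)
  have "\<exists>!h. h \<in> Hom C z b \<and> Ident C b \<cdot> h = u \<and> Ident C b \<cdot> h = v"
    if "u \<in> Hom C z b" "v \<in> Hom C z b" "m \<cdot> u = m \<cdot> v" for z u v
    using that monicD[OF assms that] Ident_Comp by metis
  then show ?thesis
    using b unfolding is_pullback_def by (auto simp: Hom_def)
qed

lemma kernel_pair_imp_monic:
  assumes k: "is_pullback C m m (Ident C b) (Ident C b)" and m: "m \<in> Hom C b a"
  shows "monic C m"
proof (rule monicI[OF m])
  fix z u v assume uv: "u \<in> Hom C z b" "v \<in> Hom C z b" "m \<cdot> u = m \<cdot> v"
  have "Dom C m = b"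
    using m by (simp add: Hom_def)
  moreover have "Dom C (Ident C b) = b"
    using Ident_in[OF Hom_Obj(1)[OF m]] by (simp add: Hom_def)
  ultimately obtain h where "h \<in> Hom C z b" "Ident C b \<cdot> h = u" "Ident C b \<cdot> h = v"
    using k uv unfolding is_pullback_def by metis
  then show "u = v"
    by simp
qed

text \<open>The second leg of the square goes to a terminal object, so it carries no information and
  the pullback property becomes a condition on \<open>u\<close> alone. Uniqueness of the mediating
  map is the monicity of \<open>m\<close>.\<close>

lemma classifies_iff:
  assumes t: "is_terminal C t" and tr: "tr \<in> Hom C t \<Omega>" and m: "monic C m" "m \<in> Hom C b a"
  shows "classifies C t tr m c \<longleftrightarrow> c \<in> Hom C a \<Omega> \<and>
    (\<forall>z. \<forall>u \<in> Hom C z a. c \<cdot> u = tr \<cdot> to_terminal C t z \<longleftrightarrow> (\<exists>h \<in> Hom C z b. m \<cdot> h = u))"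
    (is "?L \<longleftrightarrow> ?R")
proof -
  have d: "Dom C m = b" "Cod C m = a" "m \<in> Arr C" "Dom C tr = t" "Cod C tr = \<Omega>" "tr \<in> Arr C"
    using m tr by (auto simp: Hom_def)
  have tb: "to_terminal C t b \<in> Hom C b t"
    using to_terminal_in[OF t] Hom_Obj m by blast
  show ?thesis
  proof
    assume L: ?L
    then have c: "c \<in> Hom C a \<Omega>"
      by (simp add: classifies_def d)
    then have "Dom C c = a"
      by (simp add: Hom_def)
    then have sq: "c \<cdot> m = tr \<cdot> to_terminal C t b"
      and un: "\<And>z u v. \<lbrakk>u \<in> Hom C z a; v \<in> Hom C z t; c \<cdot> u = tr \<cdot> v\<rbrakk> \<Longrightarrow> \<exists>h \<in> Hom C z b. m \<cdot> h = u"
      using L unfolding classifies_def is_pullback_def d by blast+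
    have "c \<cdot> u = tr \<cdot> to_terminal C t z \<longleftrightarrow> (\<exists>h \<in> Hom C z b. m \<cdot> h = u)"
      if u: "u \<in> Hom C z a" for z u
    proof
      assume "c \<cdot> u = tr \<cdot> to_terminal C t z"
      then show "\<exists>h \<in> Hom C z b. m \<cdot> h = u"
        using un u to_terminal_in[OF t Hom_Obj(1)[OF u]] by blast
    next
      assume "\<exists>h \<in> Hom C z b. m \<cdot> h = u"
      then obtain h where h: "h \<in> Hom C z b" "m \<cdot> h = u" by blast
      have "c \<cdot> u = (c \<cdot> m) \<cdot> h"
        using Comp_assoc[OF h(1) m(2) c] h(2) by simp
      also have "\<dots> = tr \<cdot> (to_terminal C t b \<cdot> h)"
        using Comp_assoc[OF h(1) tb tr] sq by simp
      finally show "c \<cdot> u = tr \<cdot> to_terminal C t z"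
        using to_terminal_comp[OF t h(1)] by simp
    qed
    with c show ?R by blast
  next
    assume R: ?R
    then have c: "c \<in> Hom C a \<Omega>" by blast
    then have dc: "Dom C c = a" "Cod C c = \<Omega>" "c \<in> Arr C"
      by (auto simp: Hom_def)
    \<comment> \<open>Commutation of the square is the condition at \<open>u = m\<close>, which
      factors through \<open>m\<close> by the identity.\<close>
    have "c \<cdot> m = tr \<cdot> to_terminal C t b"
      using R m(2) Comp_Ident[OF m(2)] Ident_in[OF Hom_Obj(1)[OF m(2)]] by blast
    moreover have "\<exists>!h. h \<in> Hom C z b \<and> m \<cdot> h = u \<and> to_terminal C t b \<cdot> h = v"
      if uv: "u \<in> Hom C z a" "v \<in> Hom C z t" "c \<cdot> u = tr \<cdot> v" for z u v
    proof -
      have v: "v = to_terminal C t z"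
        using terminal_eq[OF t uv(2)] to_terminal_in[OF t Hom_Obj(1)[OF uv(2)]] by blast
      then obtain h where h: "h \<in> Hom C z b" "m \<cdot> h = u"
        using R uv by blast
      show ?thesis
      proof (rule ex1I[of _ h])
        show "h \<in> Hom C z b \<and> m \<cdot> h = u \<and> to_terminal C t b \<cdot> h = v"
          using h to_terminal_comp[OF t h(1)] v by simp
        show "h' = h" if "h' \<in> Hom C z b \<and> m \<cdot> h' = u \<and> to_terminal C t b \<cdot> h' = v" for h'
          using monicD[OF m] that h by blast
      qed
    qed
    ultimately show ?L
      using c d dc tb unfolding classifies_def is_pullback_def by (auto simp: Hom_def)
  qed
qed

end

section \<open>Truth of maps into \<Omega> at generalised elements\<close>

locale classified_category = category +
  fixes t \<Omega> tr
  assumes classifier: "subobject_classifier C t \<Omega> tr"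
begin

lemma terminal: "is_terminal C t"
  and tr_in: "tr \<in> Hom C t \<Omega>"
  using classifier by (auto simp: subobject_classifier_def)

text \<open>A map \<open>c\<close> into \<Omega> counts as true at a generalised element
  \<open>u\<close> of stage \<open>z\<close> when \<open>c\<close> after \<open>u\<close> equals
  \<open>true_at z\<close>.\<close>

definition true_at where
  "true_at z = tr \<cdot> to_terminal C t z"

lemma true_at_in: "z \<in> Obj C \<Longrightarrow> true_at z \<in> Hom C z \<Omega>"
  unfolding true_at_def using Comp_in[OF to_terminal_in[OF terminal] tr_in] .

lemma true_at_comp:
  assumes u: "u \<in> Hom C w z"
  shows "true_at z \<cdot> u = true_at w"
  using Comp_assoc[OF u to_terminal_in[OF terminal Hom_Obj(2)[OF u]] tr_in]
    to_terminal_comp[OF terminal u]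
  by (simp add: true_at_def)

lemma tr_comp: "h \<in> Hom C z t \<Longrightarrow> tr \<cdot> h = true_at z"
  unfolding true_at_def
  using terminal_eq[OF terminal] to_terminal_in[OF terminal] Hom_Obj by blast

lemma true_at_terminal: "true_at t = tr"
  using tr_comp[OF Ident_in[OF Hom_Obj(1)[OF tr_in]]] Comp_Ident[OF tr_in] by simp

lemma char_map_classifies: "monic C m \<Longrightarrow> classifies C t tr m (char_map C t tr m)"
  unfolding char_map_def by (rule theI') (use classifier in \<open>simp add: subobject_classifier_def\<close>)

lemma char_map_unique:
  assumes "monic C m" "classifies C t tr m c"
  shows "c = char_map C t tr m"
  using assms char_map_classifies[OF assms(1)] classifier unfolding subobject_classifier_def by blast

lemma char_map_in:
  assumes "monic C m" "m \<in> Hom C b a"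
  shows "char_map C t tr m \<in> Hom C a \<Omega>"
  using char_map_classifies[OF assms(1)] classifies_iff[OF terminal tr_in assms] by blast

lemma char_map_true_iff:
  assumes "monic C m" "m \<in> Hom C b a" "u \<in> Hom C z a"
  shows "char_map C t tr m \<cdot> u = true_at z \<longleftrightarrow> (\<exists>h \<in> Hom C z b. m \<cdot> h = u)"
  using char_map_classifies[OF assms(1)] classifies_iff[OF terminal tr_in assms(1,2)] assms(3)
  by (simp add: true_at_def)

text \<open>This is the extensionality rule by which all characteristic maps below are identified:
  it replaces equations between maps into \<Omega> by a comparison of the generalised elements at
  which they are true.\<close>

lemma char_map_eqI:
  assumes "monic C m" "m \<in> Hom C b a" "c \<in> Hom C a \<Omega>"
    and "\<And>z u. u \<in> Hom C z a \<Longrightarrow> c \<cdot> u = true_at z \<longleftrightarrow> (\<exists>h \<in> Hom C z b. m \<cdot> h = u)"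
  shows "c = char_map C t tr m"
  using assms char_map_unique classifies_iff[OF terminal tr_in assms(1,2)]
  by (simp add: true_at_def)

text \<open>The meet is true at a pair exactly when the pair factors through
  \<open>(tr, tr)\<close>. A factorisation is a map from \<open>z\<close> to the terminal object;
  there is exactly one, and its composite with \<open>(tr, tr)\<close> has \<open>true_at z\<close>
  in both components.\<close>

lemma meet_in_and_true_iff:
  assumes Q: "is_product C \<Omega> \<Omega> Q q1 q2"
  shows "meet C t tr q1 q2 \<in> Hom C Q \<Omega>"
    and "\<lbrakk>u \<in> Hom C z \<Omega>; v \<in> Hom C z \<Omega>\<rbrakk> \<Longrightarrow>
      meet C t tr q1 q2 \<cdot> pairing C q1 q2 u v = true_at z \<longleftrightarrow> u = true_at z \<and> v = true_at z"
proof -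
  note tt = pairing_props[OF Q tr_in tr_in]
  note mono = monic_from_terminal[OF terminal tt(1)]
  show "meet C t tr q1 q2 \<in> Hom C Q \<Omega>"
    unfolding meet_def by (rule char_map_in[OF mono tt(1)])
  assume uv: "u \<in> Hom C z \<Omega>" "v \<in> Hom C z \<Omega>"
  note p = pairing_props[OF Q uv]
  have z: "z \<in> Obj C"
    using uv Hom_Obj by blast
  have "pairing C q1 q2 tr tr \<cdot> h = pairing C q1 q2 u v \<longleftrightarrow> u = true_at z \<and> v = true_at z"
    if h: "h \<in> Hom C z t" for h
    using pairing_comp[OF Q tr_in tr_in h] pairing_props[OF Q true_at_in[OF z] true_at_in[OF z]]
      p tr_comp[OF h] by metis
  then show "meet C t tr q1 q2 \<cdot> pairing C q1 q2 u v = true_at z \<longleftrightarrow> u = true_at z \<and> v = true_at z"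
    unfolding meet_def char_map_true_iff[OF mono tt(1) p(1)]
    using to_terminal_in[OF terminal z] by blast
qed

end

section \<open>Terminal objects and pullbacks as limits\<close>

definition empty_shape :: "(nat, nat) cat" where
  "empty_shape = \<lparr>Obj = {}, Arr = {}, Dom = id, Cod = id, Ident = id, Comp = (\<lambda>g f. f)\<rparr>"

lemma finite_empty_shape: "finite_shape empty_shape"
  by (auto simp: finite_shape_def empty_shape_def category_def Hom_def)

text \<open>A cone over the empty shape is a bare object, and a mediating map has no legs to match.
  Leaving \<open>D\<close> and \<open>l\<close> arbitrary lets the lemma be applied to the composite
  diagram in the target of a functor as well.\<close>

lemma is_limit_empty_iff: "is_limit empty_shape C D L l \<longleftrightarrow> is_terminal C L"
  by (auto simp: is_limit_def is_cone_def empty_shape_def is_terminal_def)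

text \<open>A cospan \<open>0 \<rightarrow> 2 \<leftarrow> 1\<close> with its first leg doubled. The arrows \<open>0, 1, 2\<close> are the identities,
  \<open>3, 4 : 0 \<rightarrow> 2\<close> and \<open>5 : 1 \<rightarrow> 2\<close>; with \<open>3\<close> and \<open>4\<close> sent to the same arrow, limits of this shape are
  pullbacks.\<close>

definition cospan_shape :: "(nat, nat) cat" where
  "cospan_shape = \<lparr>Obj = {0, 1, 2}, Arr = {0, 1, 2, 3, 4, 5},
    Dom = (\<lambda>n. if n < 3 then n else if n < 5 then 0 else 1),
    Cod = (\<lambda>n. if n < 3 then n else 2),
    Ident = id,
    Comp = (\<lambda>g f. if f < 3 then g else f)\<rparr>"

definition cospan :: "('o, 'a) cat \<Rightarrow> 'a \<Rightarrow> 'a \<Rightarrow> 'a \<Rightarrow> (nat, nat, 'o, 'a) cfunctor" where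
  "cospan C s s' r = \<lparr>FObj = (\<lambda>n. if n = 0 then Dom C s else if n = 1 then Dom C r else Cod C s),
    FArr = (\<lambda>n. if n = 0 then Ident C (Dom C s) else if n = 1 then Ident C (Dom C r)
      else if n = 2 then Ident C (Cod C s) else if n = 3 then s else if n = 4 then s' else r)\<rparr>"

lemma Hom_cospan_shape_iff:
  "f \<in> Hom cospan_shape x z \<longleftrightarrow>
    f \<in> {0, 1, 2} \<and> x = f \<and> z = f \<or> f \<in> {3, 4} \<and> x = 0 \<and> z = 2 \<or> f = 5 \<and> x = 1 \<and> z = 2"
  by (auto simp: cospan_shape_def Hom_def)

lemma category_cospan_shape: "category cospan_shape"
  by unfold_locales (auto simp: cospan_shape_def Hom_def split: if_splits)

lemma finite_cospan_shape: "finite_shape cospan_shape"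
  using category_cospan_shape by (simp add: finite_shape_def) (simp add: cospan_shape_def)

context category
begin

lemma functor_cospan:
  assumes h: "s \<in> Hom C w y" "s' \<in> Hom C w y" "r \<in> Hom C b y"
  shows "is_functor cospan_shape C (cospan C s s' r)"
proof -
  have d: "Dom C s = w" "Cod C s = y" "Dom C r = b"
    using h by (auto simp: Hom_def)
  have o: "w \<in> Obj C" "y \<in> Obj C" "b \<in> Obj C"
    using h Hom_Obj by blast+
  have i: "Ident C w \<in> Hom C w w" "Ident C y \<in> Hom C y y" "Ident C b \<in> Hom C b b"
    using o Ident_in by blast+
  interpret J: category cospan_shape
    by (rule category_cospan_shape)
  show ?thesis
  proof unfold_locales
    fix x assume "x \<in> Obj cospan_shape"
    then show "FObj (cospan C s s' r) x \<in> Obj C"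
      "FArr (cospan C s s' r) (Ident cospan_shape x) = Ident C (FObj (cospan C s s' r) x)"
      using o by (auto simp: cospan_def d cospan_shape_def)
  next
    fix f x z assume "f \<in> Hom cospan_shape x z"
    then show "FArr (cospan C s s' r) f \<in> Hom C (FObj (cospan C s s' r) x) (FObj (cospan C s s' r) z)"
      using h i unfolding Hom_cospan_shape_iff by (auto simp: cospan_def d)
  next
    \<comment> \<open>Of two composable arrows of this shape one is always an identity, so the unit
      laws settle every case.\<close>
    fix f x z g v assume "f \<in> Hom cospan_shape x z" "g \<in> Hom cospan_shape z v"
    then show "FArr (cospan C s s' r) (g \<cdot>\<^bsub>cospan_shape\<^esub> f)
        = FArr (cospan C s s' r) g \<cdot> FArr (cospan C s s' r) f"
      using h[THEN Comp_Ident] h[THEN Ident_Comp] i[THEN Comp_Ident]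
      unfolding Hom_cospan_shape_iff by (auto simp: cospan_def d cospan_shape_def)
  qed
qed

text \<open>The equations at the identity arrows hold by the unit laws, and the arrow
  \<open>3\<close> determines the leg at \<open>2\<close>. What remains are the equations at
  \<open>4\<close> and \<open>5\<close>.\<close>

lemma is_cone_cospan_iff:
  assumes h: "s \<in> Hom C w y" "s' \<in> Hom C w y" "r \<in> Hom C b y"
  shows "is_cone cospan_shape C (cospan C s s' r) L l \<longleftrightarrow>
    l 0 \<in> Hom C L w \<and> l 1 \<in> Hom C L b \<and> l 2 = s \<cdot> l 0 \<and> s' \<cdot> l 0 = s \<cdot> l 0 \<and> r \<cdot> l 1 = s \<cdot> l 0"
proof -
  have d: "Dom C s = w" "Cod C s = y" "Dom C r = b"
    using h by (auto simp: Hom_def)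
  have "L \<in> Obj C \<and> l 2 \<in> Hom C L y" if "l 0 \<in> Hom C L w" "l 2 = s \<cdot> l 0"
    using that h(1) Comp_in Hom_Obj by metis
  then show ?thesis
    using Ident_Comp[of "l 0" L w] Ident_Comp[of "l 1" L b] Ident_Comp[of "l 2" L y]
    by (auto simp: is_cone_def cospan_def d cospan_shape_def)
qed

lemma is_limit_cospan_iff:
  assumes f: "f \<in> Hom C w y" and g: "g \<in> Hom C b y"
    and l: "l 0 = p" "l 1 = q" "l 2 = f \<cdot> p" and pq: "p \<in> Hom C L w" "q \<in> Hom C L b"
  shows "is_limit cospan_shape C (cospan C f f g) L l \<longleftrightarrow> is_pullback C f g p q"
proof -
  have d: "Dom C f = w" "Cod C f = y" "Dom C g = b" "Cod C g = y" "Dom C p = L" "Dom C q = L"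
    "Cod C p = w" "Cod C q = b" "f \<in> Arr C" "g \<in> Arr C" "p \<in> Arr C" "q \<in> Arr C"
    using f g pq by (auto simp: Hom_def)
  note cone = is_cone_cospan_iff[OF f f g]
  \<comment> \<open>It is enough to compare legs at \<open>0\<close> and \<open>1\<close>: on both
    sides the leg at \<open>2\<close> is \<open>f\<close> after the leg at \<open>0\<close>.\<close>
  have legs: "(\<forall>n \<in> Obj cospan_shape. l n \<cdot> h = m n) \<longleftrightarrow> p \<cdot> h = m 0 \<and> q \<cdot> h = m 1"
    if "is_cone cospan_shape C (cospan C f f g) M m" "h \<in> Hom C M L" for M m h
    using that Comp_assoc[OF that(2) pq(1) f] l unfolding cone
    by (auto simp: cospan_shape_def)
  show ?thesis
  proof
    assume lim: "is_limit cospan_shape C (cospan C f f g) L l"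
    have "\<exists>!h. h \<in> Hom C z L \<and> p \<cdot> h = u \<and> q \<cdot> h = v"
      if uv: "u \<in> Hom C z w" "v \<in> Hom C z b" "f \<cdot> u = g \<cdot> v" for z u v
    proof -
      let ?m = "\<lambda>n::nat. if n = 0 then u else if n = 1 then v else f \<cdot> u"
      have m: "is_cone cospan_shape C (cospan C f f g) z ?m"
        unfolding cone using uv by simp
      then have "\<exists>!h. h \<in> Hom C z L \<and> (\<forall>n \<in> Obj cospan_shape. l n \<cdot> h = ?m n)"
        using lim unfolding is_limit_def by blast
      then show ?thesis
        using legs[OF m] by (simp cong: conj_cong)
    qed
    moreover have "f \<cdot> p = g \<cdot> q"
      using lim unfolding is_limit_def cone l by simp
    ultimately show "is_pullback C f g p q"
      by (auto simp: is_pullback_def d)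
  next
    assume pb: "is_pullback C f g p q"
    have "\<exists>!h. h \<in> Hom C M L \<and> (\<forall>n \<in> Obj cospan_shape. l n \<cdot> h = m n)"
      if m: "is_cone cospan_shape C (cospan C f f g) M m" for M m
    proof -
      have "\<exists>!h. h \<in> Hom C M L \<and> p \<cdot> h = m 0 \<and> q \<cdot> h = m 1"
        using pb m unfolding cone is_pullback_def d by (metis (no_types, lifting))
      then show ?thesis
        using legs[OF m] by (simp cong: conj_cong)
    qed
    moreover have "is_cone cospan_shape C (cospan C f f g) L l"
      unfolding cone l using pq pb by (simp add: is_pullback_def)
    ultimately show "is_limit cospan_shape C (cospan C f f g) L l"
      by (simp add: is_limit_def)
  qed
qed

text \<open>For distinct \<open>s\<close> and \<open>s'\<close> the cone equalises a parallel pair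
  and at the same time factors the common value through \<open>r\<close>; for \<open>s = s'\<close>
  it is an ordinary commuting square. Both uses occur below.\<close>

lemma cospan_cone_exists:
  assumes "has_finite_limits C"
    and h: "s \<in> Hom C w y" "s' \<in> Hom C w y" "r \<in> Hom C b y"
  obtains z p q where "p \<in> Hom C z w" "q \<in> Hom C z b" "s \<cdot> p = r \<cdot> q" "s' \<cdot> p = r \<cdot> q"
proof -
  obtain L l where "is_limit cospan_shape C (cospan C s s' r) L l"
    using assms(1) finite_cospan_shape functor_cospan[OF h] unfolding has_finite_limits_def by blast
  then have "is_cone cospan_shape C (cospan C s s' r) L l"
    by (simp add: is_limit_def)
  then show ?thesis
    using that unfolding is_cone_cospan_iff[OF h] by metis
qed

end

section \<open>Preservation of terminal objects, pullbacks and monos\<close>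

context is_functor
begin

lemma preserves_terminal:
  assumes "preserves_finite_limits C D F" "is_terminal C t"
  shows "is_terminal D (FObj F t)"
proof -
  let ?e = "\<lparr>FObj = \<lambda>_. t, FArr = \<lambda>_. Ident C t\<rparr> :: (nat, nat, _, _) cfunctor"
  have "is_functor empty_shape C ?e"
    using finite_empty_shape source.category_axioms
    by (auto simp: finite_shape_def is_functor_def is_functor_axioms_def empty_shape_def Hom_def)
  then show ?thesis
    using assms finite_empty_shape is_limit_empty_iff unfolding preserves_finite_limits_def by metis
qed

lemma preserves_pullback:
  assumes lex: "preserves_finite_limits C D F" and pb: "is_pullback C f g p q"
  shows "is_pullback D (FArr F f) (FArr F g) (FArr F p) (FArr F q)"
proof -
  define w y b L where "w = Dom C f" and "y = Cod C f" and "b = Dom C g" and "L = Dom C p"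
  have h: "f \<in> Hom C w y" "g \<in> Hom C b y" "p \<in> Hom C L w" "q \<in> Hom C L b"
    using pb by (auto simp: is_pullback_def Hom_def w_def y_def b_def L_def)
  have o: "w \<in> Obj C" "y \<in> Obj C" "b \<in> Obj C"
    using h source.Hom_Obj by blast+
  note Fh = h[THEN FArr_in]
  let ?l = "\<lambda>n::nat. if n = 0 then p else if n = 1 then q else f \<cdot>\<^bsub>C\<^esub> p"
  have d: "Dom C f = w" "Cod C f = y" "Dom C g = b" "Dom D (FArr F f) = FObj F w"
    "Cod D (FArr F f) = FObj F y" "Dom D (FArr F g) = FObj F b"
    using h Fh by (auto simp: Hom_def)
  \<comment> \<open>The default branches of \<open>cospan\<close> make this an equality of records,
    valid at every natural number and not only at those in the shape.\<close>
  have comp: "functor_comp F (cospan C f f g) = cospan D (FArr F f) (FArr F f) (FArr F g)"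
    unfolding functor_comp_def cospan_def using o FArr_Ident by (auto simp: d)
  have "is_limit cospan_shape C (cospan C f f g) L ?l"
    using pb by (subst source.is_limit_cospan_iff[OF h(1,2) _ _ _ h(3,4)]) auto
  then have "is_limit cospan_shape D (cospan D (FArr F f) (FArr F f) (FArr F g)) (FObj F L)
      (\<lambda>n. FArr F (?l n))"
    using lex finite_cospan_shape source.functor_cospan[OF h(1) h(1) h(2)]
    unfolding preserves_finite_limits_def comp[symmetric] by blast
  then show ?thesis
    by (subst (asm) target.is_limit_cospan_iff[OF Fh(1,2) _ _ _ Fh(3,4)])
      (auto simp: FArr_Comp[OF h(3,1)])
qed

lemma preserves_monic:
  assumes lex: "preserves_finite_limits C D F" and m: "monic C m" "m \<in> Hom C b a"
  shows "monic D (FArr F m)"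
  using preserves_pullback[OF lex source.monic_imp_kernel_pair[OF m]] FArr_in[OF m(2)]
    FArr_Ident source.Hom_Obj(1)[OF m(2)] target.kernel_pair_imp_monic
  by metis

end

section \<open>The subobject classifier of the gluing\<close>

locale artin_gluing = is_functor C E F +
  source: classified_category C one\<^sub>C \<Omega>\<^sub>C true\<^sub>C +
  target: classified_category E one\<^sub>E \<Omega>\<^sub>E true\<^sub>E
  for C :: "('o, 'a) cat" and E :: "('p, 'b) cat" and F :: "('o, 'a, 'p, 'b) cfunctor"
    and one\<^sub>C \<Omega>\<^sub>C true\<^sub>C one\<^sub>E \<Omega>\<^sub>E true\<^sub>E +
  fixes P \<pi>\<^sub>1 \<pi>\<^sub>2 Q q\<^sub>1 q\<^sub>2 i
  assumes lim_E: "has_finite_limits E"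
    and lex_F: "preserves_finite_limits C E F"
    and prod: "is_product E \<Omega>\<^sub>E (FObj F \<Omega>\<^sub>C) P \<pi>\<^sub>1 \<pi>\<^sub>2"
    and prod_E: "is_product E \<Omega>\<^sub>E \<Omega>\<^sub>E Q q\<^sub>1 q\<^sub>2"
    and eq: "is_equaliser E \<pi>\<^sub>1
      (meet E one\<^sub>E true\<^sub>E q\<^sub>1 q\<^sub>2 \<cdot>\<^bsub>E\<^esub>
        prod_map E \<pi>\<^sub>1 \<pi>\<^sub>2 q\<^sub>1 q\<^sub>2 (Ident E \<Omega>\<^sub>E) (char_map E one\<^sub>E true\<^sub>E (FArr F true\<^sub>C))) i"
begin

abbreviation G where "G \<equiv> gluing C E F"
abbreviation \<chi>\<^sub>E where "\<chi>\<^sub>E \<equiv> char_map E one\<^sub>E true\<^sub>E"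
abbreviation \<chi>\<^sub>C where "\<chi>\<^sub>C \<equiv> char_map C one\<^sub>C true\<^sub>C"
abbreviation \<tau> where "\<tau> \<equiv> \<chi>\<^sub>E (FArr F true\<^sub>C)"
abbreviation conj where "conj f v \<equiv> meet E one\<^sub>E true\<^sub>E q\<^sub>1 q\<^sub>2 \<cdot>\<^bsub>E\<^esub> pairing E q\<^sub>1 q\<^sub>2 f v"
abbreviation j where "j \<equiv> to_terminal E (FObj F one\<^sub>C) one\<^sub>E"
abbreviation one\<^sub>G where "one\<^sub>G \<equiv> GObj one\<^sub>E j one\<^sub>C"
abbreviation \<Omega>\<^sub>G where "\<Omega>\<^sub>G \<equiv> GObj (Dom E i) (\<pi>\<^sub>2 \<cdot>\<^bsub>E\<^esub> i) \<Omega>\<^sub>C"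
abbreviation true\<^sub>T where
  "true\<^sub>T \<equiv> induced E i (pairing E \<pi>\<^sub>1 \<pi>\<^sub>2 true\<^sub>E (FArr F true\<^sub>C \<cdot>\<^bsub>E\<^esub> j))"
abbreviation true\<^sub>G where "true\<^sub>G \<equiv> GArr one\<^sub>G \<Omega>\<^sub>G true\<^sub>T true\<^sub>C"

sublocale G: category G
  using gluing_category is_functor_axioms .

text \<open>This is what makes \<open>j\<close> an isomorphism, and what makes
  \<open>FArr F true\<^sub>C\<close> a mono, so that \<tau> is a genuine characteristic map.\<close>

lemma F_one_terminal: "is_terminal E (FObj F one\<^sub>C)"
  using preserves_terminal[OF lex_F source.terminal] .

lemma j_in: "j \<in> Hom E one\<^sub>E (FObj F one\<^sub>C)"
  using target.to_terminal_in[OF F_one_terminal target.Hom_Obj(1)[OF target.tr_in]] .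

lemma Ftrue_in: "FArr F true\<^sub>C \<in> Hom E (FObj F one\<^sub>C) (FObj F \<Omega>\<^sub>C)"
  using FArr_in[OF source.tr_in] .

lemma Ftrue_monic: "monic E (FArr F true\<^sub>C)"
  using target.monic_from_terminal[OF F_one_terminal Ftrue_in] .

lemma \<tau>_in: "\<tau> \<in> Hom E (FObj F \<Omega>\<^sub>C) \<Omega>\<^sub>E"
  using target.char_map_in[OF Ftrue_monic Ftrue_in] .

lemma \<pi>\<^sub>1_in: "\<pi>\<^sub>1 \<in> Hom E P \<Omega>\<^sub>E" and \<pi>\<^sub>2_in: "\<pi>\<^sub>2 \<in> Hom E P (FObj F \<Omega>\<^sub>C)"
  using prod by (auto simp: is_product_def)

lemma i_in: "i \<in> Hom E (Dom E i) P"
  using eq \<pi>\<^sub>1_in by (auto simp: is_equaliser_def Hom_def)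

section \<open>The internal meet and maps into the equaliser \<open>i\<close>\<close>

lemma conj_in:
  assumes "f \<in> Hom E z \<Omega>\<^sub>E" "v \<in> Hom E z \<Omega>\<^sub>E"
  shows "conj f v \<in> Hom E z \<Omega>\<^sub>E"
  using target.Comp_in[OF target.pairing_props(1)[OF prod_E assms]
      target.meet_in_and_true_iff(1)[OF prod_E]] .

lemma conj_comp:
  assumes f: "f \<in> Hom E z \<Omega>\<^sub>E" "v \<in> Hom E z \<Omega>\<^sub>E" and u: "u \<in> Hom E w z"
  shows "conj f v \<cdot>\<^bsub>E\<^esub> u = conj (f \<cdot>\<^bsub>E\<^esub> u) (v \<cdot>\<^bsub>E\<^esub> u)"
  using target.Comp_assoc[OF u target.pairing_props(1)[OF prod_E f]
      target.meet_in_and_true_iff(1)[OF prod_E]] target.pairing_comp[OF prod_E f u]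
  by simp

text \<open>For \<open>h\<close> with components \<open>f\<close> and \<open>v\<close>, the right
  side is the meet of \<open>f\<close> with \<tau> after \<open>v\<close>. Equalising the two maps
  therefore means that \<open>f\<close> is below \<tau> after \<open>v\<close> in the internal order
  of \<Omega>.\<close>

lemma meet_prod_map_comp:
  assumes h: "h \<in> Hom E z P"
  shows "(meet E one\<^sub>E true\<^sub>E q\<^sub>1 q\<^sub>2 \<cdot>\<^bsub>E\<^esub> prod_map E \<pi>\<^sub>1 \<pi>\<^sub>2 q\<^sub>1 q\<^sub>2 (Ident E \<Omega>\<^sub>E) \<tau>) \<cdot>\<^bsub>E\<^esub> h
    = conj (\<pi>\<^sub>1 \<cdot>\<^bsub>E\<^esub> h) (\<tau> \<cdot>\<^bsub>E\<^esub> (\<pi>\<^sub>2 \<cdot>\<^bsub>E\<^esub> h))"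
  unfolding prod_map_def target.Ident_Comp[OF \<pi>\<^sub>1_in]
    conj_comp[OF \<pi>\<^sub>1_in target.Comp_in[OF \<pi>\<^sub>2_in \<tau>_in] h]
    target.Comp_assoc[OF h \<pi>\<^sub>2_in \<tau>_in] ..

lemma factor_through_i:
  assumes f: "f \<in> Hom E z \<Omega>\<^sub>E" and v: "v \<in> Hom E z (FObj F \<Omega>\<^sub>C)" and le: "conj f (\<tau> \<cdot>\<^bsub>E\<^esub> v) = f"
  shows "\<exists>!u. u \<in> Hom E z (Dom E i) \<and> i \<cdot>\<^bsub>E\<^esub> u = pairing E \<pi>\<^sub>1 \<pi>\<^sub>2 f v"
    and "induced E i (pairing E \<pi>\<^sub>1 \<pi>\<^sub>2 f v) \<in> Hom E z (Dom E i)"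
    and "i \<cdot>\<^bsub>E\<^esub> induced E i (pairing E \<pi>\<^sub>1 \<pi>\<^sub>2 f v) = pairing E \<pi>\<^sub>1 \<pi>\<^sub>2 f v"
proof -
  note p = target.pairing_props[OF prod f v]
  have d: "Dom E \<pi>\<^sub>1 = P"
    using \<pi>\<^sub>1_in by (simp add: Hom_def)
  have e: "\<pi>\<^sub>1 \<cdot>\<^bsub>E\<^esub> pairing E \<pi>\<^sub>1 \<pi>\<^sub>2 f v =
      (meet E one\<^sub>E true\<^sub>E q\<^sub>1 q\<^sub>2 \<cdot>\<^bsub>E\<^esub> prod_map E \<pi>\<^sub>1 \<pi>\<^sub>2 q\<^sub>1 q\<^sub>2 (Ident E \<Omega>\<^sub>E) \<tau>)
        \<cdot>\<^bsub>E\<^esub> pairing E \<pi>\<^sub>1 \<pi>\<^sub>2 f v"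
    unfolding meet_prod_map_comp[OF p(1)] p using le by simp
  note fac = target.equaliser_factor[OF eq p(1)[folded d] e]
  show "\<exists>!u. u \<in> Hom E z (Dom E i) \<and> i \<cdot>\<^bsub>E\<^esub> u = pairing E \<pi>\<^sub>1 \<pi>\<^sub>2 f v"
    "induced E i (pairing E \<pi>\<^sub>1 \<pi>\<^sub>2 f v) \<in> Hom E z (Dom E i)"
    "i \<cdot>\<^bsub>E\<^esub> induced E i (pairing E \<pi>\<^sub>1 \<pi>\<^sub>2 f v) = pairing E \<pi>\<^sub>1 \<pi>\<^sub>2 f v"
    by (rule fac)+
qed

text \<open>The first component of an element of the equaliser equals its meet with \<tau> of the
  second component; if that meet is true, so are both its arguments.\<close>

lemma \<tau>_true_of_\<pi>\<^sub>1_true: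
  assumes c: "c \<in> Hom E z (Dom E i)" and t: "\<pi>\<^sub>1 \<cdot>\<^bsub>E\<^esub> (i \<cdot>\<^bsub>E\<^esub> c) = target.true_at z"
  shows "\<tau> \<cdot>\<^bsub>E\<^esub> (\<pi>\<^sub>2 \<cdot>\<^bsub>E\<^esub> (i \<cdot>\<^bsub>E\<^esub> c)) = target.true_at z"
proof -
  let ?e = "meet E one\<^sub>E true\<^sub>E q\<^sub>1 q\<^sub>2 \<cdot>\<^bsub>E\<^esub> prod_map E \<pi>\<^sub>1 \<pi>\<^sub>2 q\<^sub>1 q\<^sub>2 (Ident E \<Omega>\<^sub>E) \<tau>"
  have e: "?e \<in> Hom E P \<Omega>\<^sub>E" "\<pi>\<^sub>1 \<cdot>\<^bsub>E\<^esub> i = ?e \<cdot>\<^bsub>E\<^esub> i"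
    using eq \<pi>\<^sub>1_in unfolding is_equaliser_def Hom_def by auto
  have ic: "i \<cdot>\<^bsub>E\<^esub> c \<in> Hom E z P"
    using target.Comp_in[OF c i_in] .
  have "\<pi>\<^sub>1 \<cdot>\<^bsub>E\<^esub> (i \<cdot>\<^bsub>E\<^esub> c) = ?e \<cdot>\<^bsub>E\<^esub> (i \<cdot>\<^bsub>E\<^esub> c)"
    using target.Comp_assoc[OF c i_in \<pi>\<^sub>1_in] target.Comp_assoc[OF c i_in e(1)] e(2) by simp
  also have "\<dots> = conj (\<pi>\<^sub>1 \<cdot>\<^bsub>E\<^esub> (i \<cdot>\<^bsub>E\<^esub> c)) (\<tau> \<cdot>\<^bsub>E\<^esub> (\<pi>\<^sub>2 \<cdot>\<^bsub>E\<^esub> (i \<cdot>\<^bsub>E\<^esub> c)))"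
    by (rule meet_prod_map_comp[OF ic])
  finally show ?thesis
    using target.meet_in_and_true_iff(2)[OF prod_E target.Comp_in[OF ic \<pi>\<^sub>1_in]
        target.Comp_in[OF target.Comp_in[OF ic \<pi>\<^sub>2_in] \<tau>_in]] t by simp
qed

text \<open>Since \<open>F\<close> preserves the pullback square of \<open>\<chi>\<^sub>C k\<close>, the composite \<open>\<tau> \<circ> F (\<chi>\<^sub>C k)\<close> classifies \<open>F k\<close>.\<close>

lemma \<tau>_Fchar_true_iff:
  assumes k: "monic C k" "k \<in> Hom C y x" and u: "u \<in> Hom E z (FObj F x)"
  shows "\<tau> \<cdot>\<^bsub>E\<^esub> (FArr F (\<chi>\<^sub>C k) \<cdot>\<^bsub>E\<^esub> u) = target.true_at z
    \<longleftrightarrow> (\<exists>h \<in> Hom E z (FObj F y). FArr F k \<cdot>\<^bsub>E\<^esub> h = u)"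
proof -
  let ?t = "to_terminal C one\<^sub>C y"
  have t: "?t \<in> Hom C y one\<^sub>C"
    using source.to_terminal_in[OF source.terminal source.Hom_Obj(1)[OF k(2)]] .
  have ck: "\<chi>\<^sub>C k \<in> Hom C x \<Omega>\<^sub>C"
    using source.char_map_in[OF k] .
  note Fck = FArr_in[OF ck] and Fk = FArr_in[OF k(2)] and Ft = FArr_in[OF t]
  have "Dom C k = y"
    using k(2) by (simp add: Hom_def)
  then have "is_pullback C (\<chi>\<^sub>C k) true\<^sub>C k ?t"
    using source.char_map_classifies[OF k(1)] by (simp add: classifies_def)
  then have pb: "is_pullback E (FArr F (\<chi>\<^sub>C k)) (FArr F true\<^sub>C) (FArr F k) (FArr F ?t)"
    using preserves_pullback[OF lex_F] by blast
  have d: "Dom E (FArr F (\<chi>\<^sub>C k)) = FObj F x" "Dom E (FArr F true\<^sub>C) = FObj F one\<^sub>C"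
    "Dom E (FArr F k) = FObj F y"
    using Fck Ftrue_in Fk by (auto simp: Hom_def)
  have sq: "FArr F (\<chi>\<^sub>C k) \<cdot>\<^bsub>E\<^esub> FArr F k = FArr F true\<^sub>C \<cdot>\<^bsub>E\<^esub> FArr F ?t"
    and un: "\<And>h. \<lbrakk>h \<in> Hom E z (FObj F one\<^sub>C); FArr F (\<chi>\<^sub>C k) \<cdot>\<^bsub>E\<^esub> u = FArr F true\<^sub>C \<cdot>\<^bsub>E\<^esub> h\<rbrakk>
      \<Longrightarrow> \<exists>l \<in> Hom E z (FObj F y). FArr F k \<cdot>\<^bsub>E\<^esub> l = u"
    using pb u unfolding is_pullback_def d by blast+
  have "(\<exists>h \<in> Hom E z (FObj F one\<^sub>C). FArr F true\<^sub>C \<cdot>\<^bsub>E\<^esub> h = FArr F (\<chi>\<^sub>C k) \<cdot>\<^bsub>E\<^esub> u)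
    \<longleftrightarrow> (\<exists>h \<in> Hom E z (FObj F y). FArr F k \<cdot>\<^bsub>E\<^esub> h = u)"
  proof
    assume "\<exists>h \<in> Hom E z (FObj F one\<^sub>C). FArr F true\<^sub>C \<cdot>\<^bsub>E\<^esub> h = FArr F (\<chi>\<^sub>C k) \<cdot>\<^bsub>E\<^esub> u"
    then show "\<exists>h \<in> Hom E z (FObj F y). FArr F k \<cdot>\<^bsub>E\<^esub> h = u"
      using un by metis
  next
    assume "\<exists>h \<in> Hom E z (FObj F y). FArr F k \<cdot>\<^bsub>E\<^esub> h = u"
    then obtain h where h: "h \<in> Hom E z (FObj F y)" "FArr F k \<cdot>\<^bsub>E\<^esub> h = u" by blast
    have "FArr F (\<chi>\<^sub>C k) \<cdot>\<^bsub>E\<^esub> u = FArr F true\<^sub>C \<cdot>\<^bsub>E\<^esub> (FArr F ?t \<cdot>\<^bsub>E\<^esub> h)"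
      using target.Comp_assoc[OF h(1) Fk Fck] target.Comp_assoc[OF h(1) Ft Ftrue_in] sq h(2) by simp
    then show "\<exists>h \<in> Hom E z (FObj F one\<^sub>C). FArr F true\<^sub>C \<cdot>\<^bsub>E\<^esub> h = FArr F (\<chi>\<^sub>C k) \<cdot>\<^bsub>E\<^esub> u"
      using target.Comp_in[OF h(1) Ft] by metis
  qed
  then show ?thesis
    using target.char_map_true_iff[OF Ftrue_monic Ftrue_in target.Comp_in[OF u Fck]] by simp
qed

section \<open>Terminal object, truth map and truth in the gluing\<close>

lemma one\<^sub>G_terminal: "is_terminal G one\<^sub>G"
proof -
  have o: "one\<^sub>E \<in> Obj E" "one\<^sub>C \<in> Obj C"
    using source.Hom_Obj(1)[OF source.tr_in] target.Hom_Obj(1)[OF target.tr_in] by auto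
  have 1: "one\<^sub>G \<in> Obj G"
    unfolding Obj_gluing_iff using o j_in by simp
  have "\<exists>!f. f \<in> Hom G X one\<^sub>G" if X: "X \<in> Obj G" for X
  proof (rule ex1I)
    have X': "gtop X \<in> Obj E" "gbase X \<in> Obj C" "gstr X \<in> Hom E (gtop X) (FObj F (gbase X))"
      using X unfolding Obj_gluing_iff by auto
    note s = target.to_terminal_in[OF target.terminal X'(1)]
      and t = source.to_terminal_in[OF source.terminal X'(2)]
    let ?f = "GArr X one\<^sub>G (to_terminal E one\<^sub>E (gtop X)) (to_terminal C one\<^sub>C (gbase X))"
    \<comment> \<open>The square required of \<open>?f\<close> equates two maps into
      \<open>FObj F one\<^sub>C\<close>, which is terminal, so the two components can be chosen
      independently.\<close>
    show "?f \<in> Hom G X one\<^sub>G"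
      using X 1 s t target.terminal_eq[OF F_one_terminal target.Comp_in[OF s j_in]
          target.Comp_in[OF X'(3) FArr_in[OF t]]]
      unfolding Hom_gluing_iff by simp
    show "f = ?f" if "f \<in> Hom G X one\<^sub>G" for f
      using that target.terminal_eq[OF target.terminal _ s] source.terminal_eq[OF source.terminal _ t]
      unfolding Hom_gluing_iff by (intro garr.expand) simp
  qed
  with 1 show ?thesis
    by (simp add: is_terminal_def)
qed

text \<open>This places the pair defining \<open>true\<^sub>T\<close> in the equaliser. Its second
  component factors visibly through \<open>FArr F true\<^sub>C\<close>, so \<tau> is true there, and
  the meet of true with true is true.\<close>

lemma conj_true: "conj true\<^sub>E (\<tau> \<cdot>\<^bsub>E\<^esub> (FArr F true\<^sub>C \<cdot>\<^bsub>E\<^esub> j)) = true\<^sub>E"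
proof -
  have Fj: "FArr F true\<^sub>C \<cdot>\<^bsub>E\<^esub> j \<in> Hom E one\<^sub>E (FObj F \<Omega>\<^sub>C)"
    using target.Comp_in[OF j_in Ftrue_in] .
  have "\<tau> \<cdot>\<^bsub>E\<^esub> (FArr F true\<^sub>C \<cdot>\<^bsub>E\<^esub> j) = true\<^sub>E"
    using target.char_map_true_iff[OF Ftrue_monic Ftrue_in Fj] j_in
    by (auto simp: target.true_at_terminal)
  then show ?thesis
    using target.meet_in_and_true_iff(2)[OF prod_E target.tr_in target.tr_in]
    by (simp add: target.true_at_terminal)
qed

lemmas true\<^sub>T_props =
  factor_through_i[OF target.tr_in target.Comp_in[OF j_in Ftrue_in] conj_true]

lemmas true_pairing = target.pairing_props[OF prod target.tr_in target.Comp_in[OF j_in Ftrue_in]]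

lemma \<Omega>\<^sub>G_in: "\<Omega>\<^sub>G \<in> Obj G"
  unfolding Obj_gluing_iff
  using target.Hom_Obj(1)[OF i_in] source.Hom_Obj(2)[OF source.tr_in] target.Comp_in[OF i_in \<pi>\<^sub>2_in]
  by simp

lemma true\<^sub>G_in: "true\<^sub>G \<in> Hom G one\<^sub>G \<Omega>\<^sub>G"
proof -
  have "(\<pi>\<^sub>2 \<cdot>\<^bsub>E\<^esub> i) \<cdot>\<^bsub>E\<^esub> true\<^sub>T = FArr F true\<^sub>C \<cdot>\<^bsub>E\<^esub> j"
    using target.Comp_assoc[OF true\<^sub>T_props(2) i_in \<pi>\<^sub>2_in] true\<^sub>T_props(3) true_pairing(3) by simp
  moreover have "one\<^sub>G \<in> Obj G"
    using one\<^sub>G_terminal by (simp add: is_terminal_def)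
  ultimately show ?thesis
    unfolding Hom_gluing_iff using \<Omega>\<^sub>G_in true\<^sub>T_props(2) source.tr_in by simp
qed

text \<open>The second projection of the top component does not appear on the right because the
  structure square of \<open>c\<close> expresses it through \<open>abase c\<close>. When
  \<open>abase c\<close> is true, it becomes \<open>FArr F true\<^sub>C\<close> after a map into the
  terminal object \<open>FObj F one\<^sub>C\<close>, which is the value that
  \<open>true\<^sub>T\<close> prescribes.\<close>

lemma gluing_true_iff:
  assumes c: "c \<in> Hom G X \<Omega>\<^sub>G"
  shows "c = true\<^sub>G \<cdot>\<^bsub>G\<^esub> to_terminal G one\<^sub>G X \<longleftrightarrow>
    \<pi>\<^sub>1 \<cdot>\<^bsub>E\<^esub> (i \<cdot>\<^bsub>E\<^esub> atop c) = target.true_at (gtop X) \<and> abase c = source.true_at (gbase X)"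
proof -
  define T where "T = to_terminal G one\<^sub>G X"
  have T: "T \<in> Hom G X one\<^sub>G"
    unfolding T_def using G.to_terminal_in[OF one\<^sub>G_terminal G.Hom_Obj(1)[OF c]] .
  define s r where "s = atop T" and "r = abase T"
  have sr: "s \<in> Hom E (gtop X) one\<^sub>E" "r \<in> Hom C (gbase X) one\<^sub>C" "gsrc T = X"
    "gstr X \<in> Hom E (gtop X) (FObj F (gbase X))"
    using T unfolding s_def r_def Hom_gluing_iff Obj_gluing_iff by auto
  have c': "atop c \<in> Hom E (gtop X) (Dom E i)" "abase c \<in> Hom C (gbase X) \<Omega>\<^sub>C" "gsrc c = X"
    "gtgt c = \<Omega>\<^sub>G" "(\<pi>\<^sub>2 \<cdot>\<^bsub>E\<^esub> i) \<cdot>\<^bsub>E\<^esub> atop c = FArr F (abase c) \<cdot>\<^bsub>E\<^esub> gstr X"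
    using c unfolding Hom_gluing_iff by auto
  have comp: "true\<^sub>G \<cdot>\<^bsub>G\<^esub> T = GArr X \<Omega>\<^sub>G (true\<^sub>T \<cdot>\<^bsub>E\<^esub> s) (source.true_at (gbase X))"
    using source.tr_comp[OF sr(2)] sr(3) by (simp add: gluing_simps s_def r_def)
  have ts: "true\<^sub>T \<cdot>\<^bsub>E\<^esub> s \<in> Hom E (gtop X) (Dom E i)"
    using target.Comp_in[OF sr(1) true\<^sub>T_props(2)] .
  have its: "i \<cdot>\<^bsub>E\<^esub> (true\<^sub>T \<cdot>\<^bsub>E\<^esub> s) = pairing E \<pi>\<^sub>1 \<pi>\<^sub>2 true\<^sub>E (FArr F true\<^sub>C \<cdot>\<^bsub>E\<^esub> j) \<cdot>\<^bsub>E\<^esub> s"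
    using target.Comp_assoc[OF sr(1) true\<^sub>T_props(2) i_in] true\<^sub>T_props(3) by simp
  have p1: "\<pi>\<^sub>1 \<cdot>\<^bsub>E\<^esub> (i \<cdot>\<^bsub>E\<^esub> (true\<^sub>T \<cdot>\<^bsub>E\<^esub> s)) = target.true_at (gtop X)"
    unfolding its using target.Comp_assoc[OF sr(1) true_pairing(1) \<pi>\<^sub>1_in] true_pairing(2)
      target.tr_comp[OF sr(1)] by simp
  have p2: "\<pi>\<^sub>2 \<cdot>\<^bsub>E\<^esub> (i \<cdot>\<^bsub>E\<^esub> (true\<^sub>T \<cdot>\<^bsub>E\<^esub> s)) = FArr F true\<^sub>C \<cdot>\<^bsub>E\<^esub> (j \<cdot>\<^bsub>E\<^esub> s)"
    unfolding its using target.Comp_assoc[OF sr(1) true_pairing(1) \<pi>\<^sub>2_in] true_pairing(3)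
      target.Comp_assoc[OF sr(1) j_in Ftrue_in] by simp
  show ?thesis
    unfolding T_def[symmetric] comp
  proof
    assume "c = GArr X \<Omega>\<^sub>G (true\<^sub>T \<cdot>\<^bsub>E\<^esub> s) (source.true_at (gbase X))"
    then show "\<pi>\<^sub>1 \<cdot>\<^bsub>E\<^esub> (i \<cdot>\<^bsub>E\<^esub> atop c) = target.true_at (gtop X) \<and> abase c = source.true_at (gbase X)"
      using p1 by simp
  next
    assume t: "\<pi>\<^sub>1 \<cdot>\<^bsub>E\<^esub> (i \<cdot>\<^bsub>E\<^esub> atop c) = target.true_at (gtop X) \<and> abase c = source.true_at (gbase X)"
    have "\<pi>\<^sub>2 \<cdot>\<^bsub>E\<^esub> (i \<cdot>\<^bsub>E\<^esub> atop c) = FArr F (true\<^sub>C \<cdot>\<^bsub>C\<^esub> r) \<cdot>\<^bsub>E\<^esub> gstr X"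
      using target.Comp_assoc[OF c'(1) i_in \<pi>\<^sub>2_in] c'(5) t source.tr_comp[OF sr(2)] by simp
    also have "\<dots> = FArr F true\<^sub>C \<cdot>\<^bsub>E\<^esub> (FArr F r \<cdot>\<^bsub>E\<^esub> gstr X)"
      using FArr_Comp[OF sr(2) source.tr_in] target.Comp_assoc[OF sr(4) FArr_in[OF sr(2)] Ftrue_in]
      by simp
    also have "FArr F r \<cdot>\<^bsub>E\<^esub> gstr X = j \<cdot>\<^bsub>E\<^esub> s"
      using target.terminal_eq[OF F_one_terminal target.Comp_in[OF sr(4) FArr_in[OF sr(2)]]
          target.Comp_in[OF sr(1) j_in]] .
    finally have "i \<cdot>\<^bsub>E\<^esub> atop c = i \<cdot>\<^bsub>E\<^esub> (true\<^sub>T \<cdot>\<^bsub>E\<^esub> s)"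
      using target.product_eqI[OF prod target.Comp_in[OF c'(1) i_in] target.Comp_in[OF ts i_in]]
        p1 p2 t by simp
    then have "atop c = true\<^sub>T \<cdot>\<^bsub>E\<^esub> s"
      using target.equaliser_eqI[OF eq c'(1) ts] by simp
    then show "c = GArr X \<Omega>\<^sub>G (true\<^sub>T \<cdot>\<^bsub>E\<^esub> s) (source.true_at (gbase X))"
      using t c'(3,4) by (intro garr.expand) simp
  qed
qed

lemma gluing_comp_true_iff:
  assumes c: "c \<in> Hom G X \<Omega>\<^sub>G" and u: "u \<in> Hom G W X"
  shows "c \<cdot>\<^bsub>G\<^esub> u = true\<^sub>G \<cdot>\<^bsub>G\<^esub> to_terminal G one\<^sub>G W \<longleftrightarrow>
    (\<pi>\<^sub>1 \<cdot>\<^bsub>E\<^esub> (i \<cdot>\<^bsub>E\<^esub> atop c)) \<cdot>\<^bsub>E\<^esub> atop u = target.true_at (gtop W)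
    \<and> abase c \<cdot>\<^bsub>C\<^esub> abase u = source.true_at (gbase W)"
proof -
  have h: "atop u \<in> Hom E (gtop W) (gtop X)" "atop c \<in> Hom E (gtop X) (Dom E i)"
    using c u unfolding Hom_gluing_iff by auto
  have "\<pi>\<^sub>1 \<cdot>\<^bsub>E\<^esub> (i \<cdot>\<^bsub>E\<^esub> (atop c \<cdot>\<^bsub>E\<^esub> atop u)) = (\<pi>\<^sub>1 \<cdot>\<^bsub>E\<^esub> (i \<cdot>\<^bsub>E\<^esub> atop c)) \<cdot>\<^bsub>E\<^esub> atop u"
    using target.Comp_assoc[OF h i_in] target.Comp_assoc[OF h(1) target.Comp_in[OF h(2) i_in] \<pi>\<^sub>1_in]
    by simp
  then show ?thesis
    using gluing_true_iff[OF G.Comp_in[OF u c]] by (simp add: gluing_simps)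
qed

text \<open>Maps \<open>u, v\<close> from \<open>w\<close> equalised by the base of \<open>m\<close> are compared through an object over \<open>w\<close> on which
  both extend to maps into \<open>B\<close>.\<close>

lemma monic_base:
  assumes m: "monic G m" "m \<in> Hom G B A"
  shows "monic C (abase m)"
proof -
  have m': "atop m \<in> Hom E (gtop B) (gtop A)" "abase m \<in> Hom C (gbase B) (gbase A)"
    "gstr B \<in> Hom E (gtop B) (FObj F (gbase B))" "B \<in> Obj G" "gtgt m = A"
    using m(2) unfolding Hom_gluing_iff Obj_gluing_iff by auto
  show ?thesis
  proof (rule source.monicI[OF m'(2)])
    fix w u v assume uv: "u \<in> Hom C w (gbase B)" "v \<in> Hom C w (gbase B)"
      "abase m \<cdot>\<^bsub>C\<^esub> u = abase m \<cdot>\<^bsub>C\<^esub> v"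
    obtain z p q where pq: "p \<in> Hom E z (FObj F w)" "q \<in> Hom E z (gtop B)"
      "FArr F u \<cdot>\<^bsub>E\<^esub> p = gstr B \<cdot>\<^bsub>E\<^esub> q" "FArr F v \<cdot>\<^bsub>E\<^esub> p = gstr B \<cdot>\<^bsub>E\<^esub> q"
      using target.cospan_cone_exists[OF lim_E FArr_in[OF uv(1)] FArr_in[OF uv(2)] m'(3)] by blast
    let ?W = "GObj z p w"
    have "?W \<in> Obj G"
      unfolding Obj_gluing_iff
      using pq(1) target.Hom_Obj(1)[OF pq(1)] source.Hom_Obj(1)[OF uv(1)] by simp
    then have "GArr ?W B q u \<in> Hom G ?W B" "GArr ?W B q v \<in> Hom G ?W B"
      unfolding Hom_gluing_iff using m'(4) pq uv by auto
    moreover have "m \<cdot>\<^bsub>G\<^esub> GArr ?W B q u = m \<cdot>\<^bsub>G\<^esub> GArr ?W B q v"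
      using uv(3) by (simp add: gluing_simps)
    ultimately have "GArr ?W B q u = GArr ?W B q v"
      by (rule G.monicD[OF m])
    then show "u = v" by simp
  qed
qed

text \<open>The base component of \<open>m\<close> is already known to be mono, hence so is its
  image under \<open>F\<close>. Cancelling it shows that \<open>u\<close> and \<open>v\<close> have
  the same composite with \<open>gstr B\<close>. This common composite is the structure map of an
  object over \<open>gbase B\<close>, from which both extend to maps into \<open>B\<close> by the
  identity on the base.\<close>

lemma monic_top:
  assumes m: "monic G m" "m \<in> Hom G B A"
  shows "monic E (atop m)"
proof -
  have m': "atop m \<in> Hom E (gtop B) (gtop A)" "abase m \<in> Hom C (gbase B) (gbase A)"
    "gstr B \<in> Hom E (gtop B) (FObj F (gbase B))" "gstr A \<in> Hom E (gtop A) (FObj F (gbase A))"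
    "B \<in> Obj G" "gstr A \<cdot>\<^bsub>E\<^esub> atop m = FArr F (abase m) \<cdot>\<^bsub>E\<^esub> gstr B"
    using m(2) unfolding Hom_gluing_iff Obj_gluing_iff by auto
  have Fk: "monic E (FArr F (abase m))" "FArr F (abase m) \<in> Hom E (FObj F (gbase B)) (FObj F (gbase A))"
    using preserves_monic[OF lex_F monic_base[OF m] m'(2)] FArr_in[OF m'(2)] by auto
  show ?thesis
  proof (rule target.monicI[OF m'(1)])
    fix z u v assume uv: "u \<in> Hom E z (gtop B)" "v \<in> Hom E z (gtop B)"
      "atop m \<cdot>\<^bsub>E\<^esub> u = atop m \<cdot>\<^bsub>E\<^esub> v"
    have Bu: "gstr B \<cdot>\<^bsub>E\<^esub> u \<in> Hom E z (FObj F (gbase B))"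
      and Bv: "gstr B \<cdot>\<^bsub>E\<^esub> v \<in> Hom E z (FObj F (gbase B))"
      using target.Comp_in uv(1,2) m'(3) by blast+
    have "FArr F (abase m) \<cdot>\<^bsub>E\<^esub> (gstr B \<cdot>\<^bsub>E\<^esub> w) = gstr A \<cdot>\<^bsub>E\<^esub> (atop m \<cdot>\<^bsub>E\<^esub> w)"
      if "w \<in> Hom E z (gtop B)" for w
      using target.Comp_assoc[OF that m'(3) Fk(2)] target.Comp_assoc[OF that m'(1,4)] m'(6) by simp
    then have e: "gstr B \<cdot>\<^bsub>E\<^esub> u = gstr B \<cdot>\<^bsub>E\<^esub> v"
      using target.monicD[OF Fk Bu Bv] uv by simp
    let ?W = "GObj z (gstr B \<cdot>\<^bsub>E\<^esub> u) (gbase B)"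
    let ?I = "Ident C (gbase B)"
    have b: "gbase B \<in> Obj C"
      using m'(5) unfolding Obj_gluing_iff by simp
    have "?W \<in> Obj G"
      unfolding Obj_gluing_iff using target.Hom_Obj(1)[OF uv(1)] b Bu by simp
    then have "GArr ?W B u ?I \<in> Hom G ?W B" "GArr ?W B v ?I \<in> Hom G ?W B"
      unfolding Hom_gluing_iff
      using m'(5) uv source.Ident_in[OF b] e target.Ident_Comp[OF Bv] by (auto simp: FArr_Ident[OF b])
    moreover have "m \<cdot>\<^bsub>G\<^esub> GArr ?W B u ?I = m \<cdot>\<^bsub>G\<^esub> GArr ?W B v ?I"
      using uv(3) by (simp add: gluing_simps)
    ultimately have "GArr ?W B u ?I = GArr ?W B v ?I"
      by (rule G.monicD[OF m])
    then show "u = v" by simp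
  qed
qed

section \<open>A fixed mono of the gluing and its characteristic map\<close>

context
  fixes m A B
  assumes m: "monic G m" and m_in: "m \<in> Hom G B A"
begin

abbreviation (input) g where "g \<equiv> atop m"
abbreviation (input) k where "k \<equiv> abase m"
abbreviation (input) \<alpha> where "\<alpha> \<equiv> gstr A"
abbreviation (input) \<beta> where "\<beta> \<equiv> gstr B"

lemma m_simps:
  shows g_in: "g \<in> Hom E (gtop B) (gtop A)" and k_in: "k \<in> Hom C (gbase B) (gbase A)"
    and \<beta>_in: "\<beta> \<in> Hom E (gtop B) (FObj F (gbase B))"
    and \<alpha>_in: "\<alpha> \<in> Hom E (gtop A) (FObj F (gbase A))"
    and B_in: "B \<in> Obj G" and A_in: "A \<in> Obj G" and m_tgt: "gtgt m = A" "gsrc m = B"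
    and square: "\<alpha> \<cdot>\<^bsub>E\<^esub> g = FArr F k \<cdot>\<^bsub>E\<^esub> \<beta>"
  using m_in unfolding Hom_gluing_iff Obj_gluing_iff by auto

lemma g_monic: "monic E g" and k_monic: "monic C k"
  using monic_top[OF m m_in] monic_base[OF m m_in] .

lemma Fk_in: "FArr F k \<in> Hom E (FObj F (gbase B)) (FObj F (gbase A))"
  using FArr_in[OF k_in] .

lemma \<chi>g_in: "\<chi>\<^sub>E g \<in> Hom E (gtop A) \<Omega>\<^sub>E" and \<chi>k_in: "\<chi>\<^sub>C k \<in> Hom C (gbase A) \<Omega>\<^sub>C"
  using target.char_map_in[OF g_monic g_in] source.char_map_in[OF k_monic k_in] .

lemma F\<chi>k\<alpha>_in: "FArr F (\<chi>\<^sub>C k) \<cdot>\<^bsub>E\<^esub> \<alpha> \<in> Hom E (gtop A) (FObj F \<Omega>\<^sub>C)"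
  using target.Comp_in[OF \<alpha>_in FArr_in[OF \<chi>k_in]] .

lemma \<tau>_F\<chi>k\<alpha>_true_iff:
  assumes u: "u \<in> Hom E z (gtop A)"
  shows "\<tau> \<cdot>\<^bsub>E\<^esub> ((FArr F (\<chi>\<^sub>C k) \<cdot>\<^bsub>E\<^esub> \<alpha>) \<cdot>\<^bsub>E\<^esub> u) = target.true_at z
    \<longleftrightarrow> (\<exists>h \<in> Hom E z (FObj F (gbase B)). FArr F k \<cdot>\<^bsub>E\<^esub> h = \<alpha> \<cdot>\<^bsub>E\<^esub> u)"
  unfolding target.Comp_assoc[OF u \<alpha>_in FArr_in[OF \<chi>k_in]]
  by (rule \<tau>_Fchar_true_iff[OF k_monic k_in target.Comp_in[OF u \<alpha>_in]])

text \<open>This is the inequality of subobjects \<open>g \<le> \<alpha>\<^sup>* (F k)\<close>, which is what the square of \<open>m\<close> says.\<close>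

lemma conj_\<chi>g: "conj (\<chi>\<^sub>E g) (\<tau> \<cdot>\<^bsub>E\<^esub> (FArr F (\<chi>\<^sub>C k) \<cdot>\<^bsub>E\<^esub> \<alpha>)) = \<chi>\<^sub>E g"
proof (rule target.char_map_eqI[OF g_monic g_in])
  let ?w = "\<tau> \<cdot>\<^bsub>E\<^esub> (FArr F (\<chi>\<^sub>C k) \<cdot>\<^bsub>E\<^esub> \<alpha>)"
  have w: "?w \<in> Hom E (gtop A) \<Omega>\<^sub>E"
    using target.Comp_in[OF F\<chi>k\<alpha>_in \<tau>_in] .
  show "conj (\<chi>\<^sub>E g) ?w \<in> Hom E (gtop A) \<Omega>\<^sub>E"
    using conj_in[OF \<chi>g_in w] .
  fix z u assume u: "u \<in> Hom E z (gtop A)"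
  have "conj (\<chi>\<^sub>E g) ?w \<cdot>\<^bsub>E\<^esub> u = target.true_at z \<longleftrightarrow>
      \<chi>\<^sub>E g \<cdot>\<^bsub>E\<^esub> u = target.true_at z \<and> ?w \<cdot>\<^bsub>E\<^esub> u = target.true_at z"
    unfolding conj_comp[OF \<chi>g_in w u]
    by (rule target.meet_in_and_true_iff(2)[OF prod_E target.Comp_in[OF u \<chi>g_in] target.Comp_in[OF u w]])
  also have "\<dots> \<longleftrightarrow> (\<exists>h \<in> Hom E z (gtop B). g \<cdot>\<^bsub>E\<^esub> h = u) \<and>
      (\<exists>h \<in> Hom E z (FObj F (gbase B)). FArr F k \<cdot>\<^bsub>E\<^esub> h = \<alpha> \<cdot>\<^bsub>E\<^esub> u)"
    unfolding target.char_map_true_iff[OF g_monic g_in u] target.Comp_assoc[OF u F\<chi>k\<alpha>_in \<tau>_in]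
      \<tau>_F\<chi>k\<alpha>_true_iff[OF u] ..
  also have "\<dots> \<longleftrightarrow> (\<exists>h \<in> Hom E z (gtop B). g \<cdot>\<^bsub>E\<^esub> h = u)"
  proof -
    have "\<exists>l \<in> Hom E z (FObj F (gbase B)). FArr F k \<cdot>\<^bsub>E\<^esub> l = \<alpha> \<cdot>\<^bsub>E\<^esub> (g \<cdot>\<^bsub>E\<^esub> h)"
      if h: "h \<in> Hom E z (gtop B)" for h
      using target.Comp_assoc[OF h g_in \<alpha>_in] target.Comp_assoc[OF h \<beta>_in Fk_in] square
        target.Comp_in[OF h \<beta>_in] by metis
    then show ?thesis by blast
  qed
  finally show "conj (\<chi>\<^sub>E g) ?w \<cdot>\<^bsub>E\<^esub> u = target.true_at z \<longleftrightarrow>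
      (\<exists>h \<in> Hom E z (gtop B). g \<cdot>\<^bsub>E\<^esub> h = u)" .
qed

lemmas \<chi>\<beta>_props = factor_through_i[OF \<chi>g_in F\<chi>k\<alpha>_in conj_\<chi>g]

text \<open>Factorisations of the two components, found separately, automatically form a map of the
  gluing: the square they must satisfy commutes after composition with \<open>FArr F k\<close>, and
  that map is mono.\<close>

lemma factor_iff:
  assumes u: "u \<in> Hom G W A"
  shows "(\<exists>h \<in> Hom G W B. m \<cdot>\<^bsub>G\<^esub> h = u) \<longleftrightarrow>
    \<chi>\<^sub>E g \<cdot>\<^bsub>E\<^esub> atop u = target.true_at (gtop W) \<and> \<chi>\<^sub>C k \<cdot>\<^bsub>C\<^esub> abase u = source.true_at (gbase W)"
proof -
  have u': "atop u \<in> Hom E (gtop W) (gtop A)" "abase u \<in> Hom C (gbase W) (gbase A)" "W \<in> Obj G"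
    "gstr W \<in> Hom E (gtop W) (FObj F (gbase W))" "gsrc u = W" "gtgt u = A"
    "\<alpha> \<cdot>\<^bsub>E\<^esub> atop u = FArr F (abase u) \<cdot>\<^bsub>E\<^esub> gstr W"
    using u unfolding Hom_gluing_iff Obj_gluing_iff by auto
  show ?thesis
    unfolding target.char_map_true_iff[OF g_monic g_in u'(1)]
      source.char_map_true_iff[OF k_monic k_in u'(2)]
  proof
    assume "\<exists>h \<in> Hom G W B. m \<cdot>\<^bsub>G\<^esub> h = u"
    then show "(\<exists>h \<in> Hom E (gtop W) (gtop B). g \<cdot>\<^bsub>E\<^esub> h = atop u) \<and>
        (\<exists>h \<in> Hom C (gbase W) (gbase B). k \<cdot>\<^bsub>C\<^esub> h = abase u)"
      by (auto simp: gluing_simps(5) Hom_gluing_iff)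
  next
    assume "(\<exists>h \<in> Hom E (gtop W) (gtop B). g \<cdot>\<^bsub>E\<^esub> h = atop u) \<and>
        (\<exists>h \<in> Hom C (gbase W) (gbase B). k \<cdot>\<^bsub>C\<^esub> h = abase u)"
    then obtain h l where hl: "h \<in> Hom E (gtop W) (gtop B)" "g \<cdot>\<^bsub>E\<^esub> h = atop u"
      "l \<in> Hom C (gbase W) (gbase B)" "k \<cdot>\<^bsub>C\<^esub> l = abase u" by blast
    have "FArr F k \<cdot>\<^bsub>E\<^esub> (\<beta> \<cdot>\<^bsub>E\<^esub> h) = \<alpha> \<cdot>\<^bsub>E\<^esub> atop u"
      using target.Comp_assoc[OF hl(1) \<beta>_in Fk_in] target.Comp_assoc[OF hl(1) g_in \<alpha>_in] square hl(2)
      by simp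
    also have "\<dots> = FArr F k \<cdot>\<^bsub>E\<^esub> (FArr F l \<cdot>\<^bsub>E\<^esub> gstr W)"
      using u'(7) hl(4) FArr_Comp[OF hl(3) k_in] target.Comp_assoc[OF u'(4) FArr_in[OF hl(3)] Fk_in]
      by simp
    finally have "\<beta> \<cdot>\<^bsub>E\<^esub> h = FArr F l \<cdot>\<^bsub>E\<^esub> gstr W"
      using target.monicD[OF preserves_monic[OF lex_F k_monic k_in] Fk_in target.Comp_in[OF hl(1) \<beta>_in]
          target.Comp_in[OF u'(4) FArr_in[OF hl(3)]]] by blast
    then have "GArr W B h l \<in> Hom G W B"
      unfolding Hom_gluing_iff using u'(3) B_in hl by simp
    moreover have "m \<cdot>\<^bsub>G\<^esub> GArr W B h l = u"
      using hl u'(5,6) m_tgt by (intro garr.expand) (simp add: gluing_simps)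
    ultimately show "\<exists>h \<in> Hom G W B. m \<cdot>\<^bsub>G\<^esub> h = u" by blast
  qed
qed

text \<open>The classifying property constrains the two components of \<open>c\<close> only jointly,
  at maps of the gluing. To isolate one of them, a given element is paired with a partner at which
  the other component is already true. The base comes before the top because the argument for the
  top uses \<open>abase c = \<chi>\<^sub>C k\<close>.\<close>

lemma classifies_imp_components:
  assumes cl: "classifies G one\<^sub>G true\<^sub>G m c"
  shows "abase c = \<chi>\<^sub>C k" and "\<pi>\<^sub>1 \<cdot>\<^bsub>E\<^esub> (i \<cdot>\<^bsub>E\<^esub> atop c) = \<chi>\<^sub>E g"
proof -
  define f where "f = \<pi>\<^sub>1 \<cdot>\<^bsub>E\<^esub> (i \<cdot>\<^bsub>E\<^esub> atop c)"
  have c: "c \<in> Hom G A \<Omega>\<^sub>G"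
    and "\<And>W u. u \<in> Hom G W A \<Longrightarrow>
      c \<cdot>\<^bsub>G\<^esub> u = true\<^sub>G \<cdot>\<^bsub>G\<^esub> to_terminal G one\<^sub>G W \<longleftrightarrow> (\<exists>h \<in> Hom G W B. m \<cdot>\<^bsub>G\<^esub> h = u)"
    using cl G.classifies_iff[OF one\<^sub>G_terminal true\<^sub>G_in m m_in] by blast+
  then have fac: "f \<cdot>\<^bsub>E\<^esub> atop u = target.true_at (gtop W) \<and> abase c \<cdot>\<^bsub>C\<^esub> abase u = source.true_at (gbase W)
      \<longleftrightarrow> (\<exists>h \<in> Hom G W B. m \<cdot>\<^bsub>G\<^esub> h = u)" if "u \<in> Hom G W A" for W u
    using gluing_comp_true_iff that unfolding f_def by blast
  have c': "atop c \<in> Hom E (gtop A) (Dom E i)" "abase c \<in> Hom C (gbase A) \<Omega>\<^sub>C"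
    "(\<pi>\<^sub>2 \<cdot>\<^bsub>E\<^esub> i) \<cdot>\<^bsub>E\<^esub> atop c = FArr F (abase c) \<cdot>\<^bsub>E\<^esub> \<alpha>"
    using c unfolding Hom_gluing_iff by auto
  have ic: "i \<cdot>\<^bsub>E\<^esub> atop c \<in> Hom E (gtop A) P"
    using target.Comp_in[OF c'(1) i_in] .
  have f: "f \<in> Hom E (gtop A) \<Omega>\<^sub>E"
    unfolding f_def using target.Comp_in[OF ic \<pi>\<^sub>1_in] .
  \<comment> \<open>Since \<open>m\<close> factors through itself, \<open>f\<close> is true at
    \<open>g\<close> and \<open>abase c\<close> is true at \<open>k\<close>.\<close>
  have "m \<cdot>\<^bsub>G\<^esub> Ident G B = m"
    using G.Comp_Ident[OF m_in] .
  then have mtrue: "f \<cdot>\<^bsub>E\<^esub> g = target.true_at (gtop B)" "abase c \<cdot>\<^bsub>C\<^esub> k = source.true_at (gbase B)"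
    using fac[OF m_in] G.Ident_in[OF B_in] by blast+
  show base: "abase c = \<chi>\<^sub>C k"
  proof (rule source.char_map_eqI[OF k_monic k_in c'(2)])
    fix w u assume u: "u \<in> Hom C w (gbase A)"
    show "abase c \<cdot>\<^bsub>C\<^esub> u = source.true_at w \<longleftrightarrow> (\<exists>h \<in> Hom C w (gbase B). k \<cdot>\<^bsub>C\<^esub> h = u)"
    proof
      assume "\<exists>h \<in> Hom C w (gbase B). k \<cdot>\<^bsub>C\<^esub> h = u"
      then obtain h where h: "h \<in> Hom C w (gbase B)" "k \<cdot>\<^bsub>C\<^esub> h = u" by blast
      then show "abase c \<cdot>\<^bsub>C\<^esub> u = source.true_at w"
        using source.Comp_assoc[OF h(1) k_in c'(2)] mtrue(2) source.true_at_comp[OF h(1)] by simp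
    next
      assume ut: "abase c \<cdot>\<^bsub>C\<^esub> u = source.true_at w"
      \<comment> \<open>The partner of \<open>u\<close> is a map \<open>p\<close> into the top at
        which \<open>f\<close> is true. The next cone makes it compatible with \<open>u\<close>:
        after restriction along \<open>q\<close>, both lie over the same map into
        \<open>FObj F (gbase A)\<close>.\<close>
      obtain z p r where p: "p \<in> Hom E z (gtop A)" "r \<in> Hom E z one\<^sub>E" "f \<cdot>\<^bsub>E\<^esub> p = true\<^sub>E \<cdot>\<^bsub>E\<^esub> r"
        using target.cospan_cone_exists[OF lim_E f f target.tr_in] by blast
      obtain z' p' q where q: "p' \<in> Hom E z' (FObj F w)" "q \<in> Hom E z' z"
        "FArr F u \<cdot>\<^bsub>E\<^esub> p' = (\<alpha> \<cdot>\<^bsub>E\<^esub> p) \<cdot>\<^bsub>E\<^esub> q"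
        using target.cospan_cone_exists[OF lim_E FArr_in[OF u] FArr_in[OF u]
            target.Comp_in[OF p(1) \<alpha>_in]] by blast
      let ?W = "GObj z' p' w"
      have pq: "p \<cdot>\<^bsub>E\<^esub> q \<in> Hom E z' (gtop A)"
        using target.Comp_in[OF q(2) p(1)] .
      have "?W \<in> Obj G"
        unfolding Obj_gluing_iff
        using q(1) target.Hom_Obj(1)[OF q(1)] source.Hom_Obj(1)[OF u] by simp
      then have U: "GArr ?W A (p \<cdot>\<^bsub>E\<^esub> q) u \<in> Hom G ?W A"
        unfolding Hom_gluing_iff
        using A_in pq u q(3) target.Comp_assoc[OF q(2) p(1) \<alpha>_in] by simp
      have "f \<cdot>\<^bsub>E\<^esub> (p \<cdot>\<^bsub>E\<^esub> q) = target.true_at z'"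
        using target.Comp_assoc[OF q(2) p(1) f] p(3) target.tr_comp[OF p(2)]
          target.true_at_comp[OF q(2)] by simp
      then obtain h where "h \<in> Hom G ?W B" "m \<cdot>\<^bsub>G\<^esub> h = GArr ?W A (p \<cdot>\<^bsub>E\<^esub> q) u"
        using fac[OF U] ut by auto
      then show "\<exists>h \<in> Hom C w (gbase B). k \<cdot>\<^bsub>C\<^esub> h = u"
        unfolding Hom_gluing_iff by (auto simp: gluing_simps)
    qed
  qed
  have "f = \<chi>\<^sub>E g"
  proof (rule target.char_map_eqI[OF g_monic g_in f])
    fix z u assume u: "u \<in> Hom E z (gtop A)"
    show "f \<cdot>\<^bsub>E\<^esub> u = target.true_at z \<longleftrightarrow> (\<exists>h \<in> Hom E z (gtop B). g \<cdot>\<^bsub>E\<^esub> h = u)"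
    proof
      assume "\<exists>h \<in> Hom E z (gtop B). g \<cdot>\<^bsub>E\<^esub> h = u"
      then obtain h where h: "h \<in> Hom E z (gtop B)" "g \<cdot>\<^bsub>E\<^esub> h = u" by blast
      then show "f \<cdot>\<^bsub>E\<^esub> u = target.true_at z"
        using target.Comp_assoc[OF h(1) g_in f] mtrue(1) target.true_at_comp[OF h(1)] by simp
    next
      assume ut: "f \<cdot>\<^bsub>E\<^esub> u = target.true_at z"
      \<comment> \<open>Truth of \<open>f\<close> at \<open>u\<close> forces, by the equaliser,
        truth of \<tau> at the second component. That component comes from
        \<open>\<chi>\<^sub>C k\<close>, so \<alpha> after \<open>u\<close> lifts through
        \<open>FArr F k\<close>. The lift \<open>w\<close> is the structure map of an object over
        \<open>gbase B\<close>, and there \<open>k\<close> is the partner of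
        \<open>u\<close>.\<close>
      have icu: "i \<cdot>\<^bsub>E\<^esub> (atop c \<cdot>\<^bsub>E\<^esub> u) = (i \<cdot>\<^bsub>E\<^esub> atop c) \<cdot>\<^bsub>E\<^esub> u"
        using target.Comp_assoc[OF u c'(1) i_in] by simp
      have "\<pi>\<^sub>1 \<cdot>\<^bsub>E\<^esub> (i \<cdot>\<^bsub>E\<^esub> (atop c \<cdot>\<^bsub>E\<^esub> u)) = target.true_at z"
        using ut target.Comp_assoc[OF u ic \<pi>\<^sub>1_in] unfolding icu f_def by simp
      then have "\<tau> \<cdot>\<^bsub>E\<^esub> (\<pi>\<^sub>2 \<cdot>\<^bsub>E\<^esub> (i \<cdot>\<^bsub>E\<^esub> (atop c \<cdot>\<^bsub>E\<^esub> u))) = target.true_at z"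
        by (rule \<tau>_true_of_\<pi>\<^sub>1_true[OF target.Comp_in[OF u c'(1)]])
      moreover have "\<pi>\<^sub>2 \<cdot>\<^bsub>E\<^esub> (i \<cdot>\<^bsub>E\<^esub> (atop c \<cdot>\<^bsub>E\<^esub> u)) = (FArr F (\<chi>\<^sub>C k) \<cdot>\<^bsub>E\<^esub> \<alpha>) \<cdot>\<^bsub>E\<^esub> u"
        unfolding icu
        using target.Comp_assoc[OF u ic \<pi>\<^sub>2_in] target.Comp_assoc[OF c'(1) i_in \<pi>\<^sub>2_in] c'(3) base by simp
      ultimately obtain w where w: "w \<in> Hom E z (FObj F (gbase B))" "FArr F k \<cdot>\<^bsub>E\<^esub> w = \<alpha> \<cdot>\<^bsub>E\<^esub> u"
        using \<tau>_F\<chi>k\<alpha>_true_iff[OF u] by auto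
      let ?W = "GObj z w (gbase B)"
      have "?W \<in> Obj G"
        unfolding Obj_gluing_iff
        using w(1) target.Hom_Obj(1)[OF u] source.Hom_Obj(1)[OF k_in] by simp
      then have U: "GArr ?W A u k \<in> Hom G ?W A"
        unfolding Hom_gluing_iff using A_in u k_in w by simp
      obtain h where "h \<in> Hom G ?W B" "m \<cdot>\<^bsub>G\<^esub> h = GArr ?W A u k"
        using fac[OF U] ut mtrue(2) by auto
      then show "\<exists>h \<in> Hom E z (gtop B). g \<cdot>\<^bsub>E\<^esub> h = u"
        unfolding Hom_gluing_iff by (auto simp: gluing_simps)
    qed
  qed
  then show "\<pi>\<^sub>1 \<cdot>\<^bsub>E\<^esub> (i \<cdot>\<^bsub>E\<^esub> atop c) = \<chi>\<^sub>E g"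
    by (simp add: f_def)
qed

text \<open>In the form of an equivalence with an equation, this gives existence and uniqueness of
  the classifying map and its value together.\<close>

lemma gluing_classifies_iff:
  "classifies G one\<^sub>G true\<^sub>G m c \<longleftrightarrow>
    c = GArr A \<Omega>\<^sub>G (induced E i (pairing E \<pi>\<^sub>1 \<pi>\<^sub>2 (\<chi>\<^sub>E g) (FArr F (\<chi>\<^sub>C k) \<cdot>\<^bsub>E\<^esub> \<alpha>))) (\<chi>\<^sub>C k)"
    (is "_ \<longleftrightarrow> c = GArr A \<Omega>\<^sub>G ?d _")
proof -
  note p = target.pairing_props[OF prod \<chi>g_in F\<chi>k\<alpha>_in]
  have id: "i \<cdot>\<^bsub>E\<^esub> ?d \<in> Hom E (gtop A) P"
    using target.Comp_in[OF \<chi>\<beta>_props(2) i_in] .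
  show ?thesis
  proof
    assume cl: "classifies G one\<^sub>G true\<^sub>G m c"
    note comps = classifies_imp_components[OF cl]
    have c: "c \<in> Hom G A \<Omega>\<^sub>G"
      using cl G.classifies_iff[OF one\<^sub>G_terminal true\<^sub>G_in m m_in] by blast
    then have c': "atop c \<in> Hom E (gtop A) (Dom E i)" "gsrc c = A" "gtgt c = \<Omega>\<^sub>G"
      "(\<pi>\<^sub>2 \<cdot>\<^bsub>E\<^esub> i) \<cdot>\<^bsub>E\<^esub> atop c = FArr F (abase c) \<cdot>\<^bsub>E\<^esub> \<alpha>"
      unfolding Hom_gluing_iff by auto
    have "\<pi>\<^sub>2 \<cdot>\<^bsub>E\<^esub> (i \<cdot>\<^bsub>E\<^esub> atop c) = FArr F (\<chi>\<^sub>C k) \<cdot>\<^bsub>E\<^esub> \<alpha>"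
      using target.Comp_assoc[OF c'(1) i_in \<pi>\<^sub>2_in] c'(4) comps(1) by simp
    \<comment> \<open>A map into \<open>P\<close> is determined by its two projections. The first is
      given by the classifying property, the second by the structure square of \<open>c\<close> and
      the known base.\<close>
    then have "i \<cdot>\<^bsub>E\<^esub> atop c = i \<cdot>\<^bsub>E\<^esub> ?d"
      using target.product_eqI[OF prod target.Comp_in[OF c'(1) i_in] id] comps(2) p(2,3)
      unfolding \<chi>\<beta>_props(3) by simp
    then have "atop c = ?d"
      by (rule target.equaliser_eqI[OF eq c'(1) \<chi>\<beta>_props(2)])
    then show "c = GArr A \<Omega>\<^sub>G ?d (\<chi>\<^sub>C k)"
      using comps(1) c'(2,3) by (intro garr.expand) simp
  next
    assume c_eq: "c = GArr A \<Omega>\<^sub>G ?d (\<chi>\<^sub>C k)"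
    have "(\<pi>\<^sub>2 \<cdot>\<^bsub>E\<^esub> i) \<cdot>\<^bsub>E\<^esub> ?d = FArr F (\<chi>\<^sub>C k) \<cdot>\<^bsub>E\<^esub> \<alpha>"
      using target.Comp_assoc[OF \<chi>\<beta>_props(2) i_in \<pi>\<^sub>2_in] \<chi>\<beta>_props(3) p(3) by simp
    then have c: "c \<in> Hom G A \<Omega>\<^sub>G"
      unfolding Hom_gluing_iff using A_in \<Omega>\<^sub>G_in \<chi>\<beta>_props(2) \<chi>k_in by (simp add: c_eq)
    have "\<pi>\<^sub>1 \<cdot>\<^bsub>E\<^esub> (i \<cdot>\<^bsub>E\<^esub> atop c) = \<chi>\<^sub>E g" "abase c = \<chi>\<^sub>C k"
      using \<chi>\<beta>_props(3) p(2) by (simp_all add: c_eq)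
    then have "c \<cdot>\<^bsub>G\<^esub> u = true\<^sub>G \<cdot>\<^bsub>G\<^esub> to_terminal G one\<^sub>G W \<longleftrightarrow> (\<exists>h \<in> Hom G W B. m \<cdot>\<^bsub>G\<^esub> h = u)"
      if "u \<in> Hom G W A" for W u
      unfolding gluing_comp_true_iff[OF c that] factor_iff[OF that] by simp
    with c show "classifies G one\<^sub>G true\<^sub>G m c"
      unfolding G.classifies_iff[OF one\<^sub>G_terminal true\<^sub>G_in m m_in] by blast
  qed
qed

lemma gluing_char_map:
  "char_map G one\<^sub>G true\<^sub>G m =
    GArr A \<Omega>\<^sub>G (induced E i (pairing E \<pi>\<^sub>1 \<pi>\<^sub>2 (\<chi>\<^sub>E g) (FArr F (\<chi>\<^sub>C k) \<cdot>\<^bsub>E\<^esub> \<alpha>))) (\<chi>\<^sub>C k)"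
  unfolding char_map_def gluing_classifies_iff by simp

end

lemma gluing_subobject_classifier: "subobject_classifier G one\<^sub>G \<Omega>\<^sub>G true\<^sub>G"
proof -
  have "\<exists>!c. classifies G one\<^sub>G true\<^sub>G m c" if m: "monic G m" for m
  proof -
    have m_in: "m \<in> Hom G (Dom G m) (Cod G m)"
      using m by (simp add: monic_def Hom_def)
    show ?thesis
      unfolding gluing_classifies_iff[OF m m_in] by simp
  qed
  then show ?thesis
    unfolding subobject_classifier_def using one\<^sub>G_terminal true\<^sub>G_in by blast
qed

end

text \<open>\<open>induced\<close> and \<open>char_map\<close> are definite descriptions. The
  unique-existence clauses, the classifier clause and the monicity of \<open>g\<close> and
  \<open>k\<close> ensure that each of them denotes the intended map; \<open>iso E j\<close> is the
  identification of the two terminal objects of \<open>E\<close>.\<close>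

theorem theorem2p9:
  fixes C :: "('o, 'a) cat" and E :: "('p, 'b) cat" and F :: "('o, 'a, 'p, 'b) cfunctor"
  assumes F: "is_functor C E F"
    and sub_C: "subobject_classifier C one\<^sub>C \<Omega>\<^sub>C true\<^sub>C"
    and sub_E: "subobject_classifier E one\<^sub>E \<Omega>\<^sub>E true\<^sub>E"
    and lim_E: "has_finite_limits E"
    and lex_F: "preserves_finite_limits C E F"
    and prod: "is_product E \<Omega>\<^sub>E (FObj F \<Omega>\<^sub>C) P \<pi>\<^sub>1 \<pi>\<^sub>2"
    and prod_E: "is_product E \<Omega>\<^sub>E \<Omega>\<^sub>E Q q\<^sub>1 q\<^sub>2"
    and eq: "is_equaliser E \<pi>\<^sub>1
      (meet E one\<^sub>E true\<^sub>E q\<^sub>1 q\<^sub>2 \<cdot>\<^bsub>E\<^esub>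
        prod_map E \<pi>\<^sub>1 \<pi>\<^sub>2 q\<^sub>1 q\<^sub>2 (Ident E \<Omega>\<^sub>E) (char_map E one\<^sub>E true\<^sub>E (FArr F true\<^sub>C))) i"
    and j: "j = to_terminal E (FObj F one\<^sub>C) one\<^sub>E"
    and true_top: "true\<^sub>T = induced E i (pairing E \<pi>\<^sub>1 \<pi>\<^sub>2 true\<^sub>E (FArr F true\<^sub>C \<cdot>\<^bsub>E\<^esub> j))"
    and one_G: "one\<^sub>G = GObj one\<^sub>E j one\<^sub>C"
    and Omega_G: "\<Omega>\<^sub>G = GObj (Dom E i) (\<pi>\<^sub>2 \<cdot>\<^bsub>E\<^esub> i) \<Omega>\<^sub>C"
    and true_G: "true\<^sub>G = GArr one\<^sub>G \<Omega>\<^sub>G true\<^sub>T true\<^sub>C"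
  shows "iso E j
    \<and> (\<exists>!u. u \<in> Hom E one\<^sub>E (Dom E i) \<and>
        i \<cdot>\<^bsub>E\<^esub> u = pairing E \<pi>\<^sub>1 \<pi>\<^sub>2 true\<^sub>E (FArr F true\<^sub>C \<cdot>\<^bsub>E\<^esub> j))
    \<and> subobject_classifier (gluing C E F) one\<^sub>G \<Omega>\<^sub>G true\<^sub>G
    \<and> (\<forall>b \<beta> y a \<alpha> x g k.
        monic (gluing C E F) (GArr (GObj b \<beta> y) (GObj a \<alpha> x) g k) \<longrightarrow>
          monic E g \<and> monic C k
          \<and> (\<exists>!u. u \<in> Hom E a (Dom E i) \<and>
              i \<cdot>\<^bsub>E\<^esub> u = pairing E \<pi>\<^sub>1 \<pi>\<^sub>2 (char_map E one\<^sub>E true\<^sub>E g)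
                (FArr F (char_map C one\<^sub>C true\<^sub>C k) \<cdot>\<^bsub>E\<^esub> \<alpha>))
          \<and> char_map (gluing C E F) one\<^sub>G true\<^sub>G (GArr (GObj b \<beta> y) (GObj a \<alpha> x) g k)
            = GArr (GObj a \<alpha> x) \<Omega>\<^sub>G
                (induced E i (pairing E \<pi>\<^sub>1 \<pi>\<^sub>2 (char_map E one\<^sub>E true\<^sub>E g)
                  (FArr F (char_map C one\<^sub>C true\<^sub>C k) \<cdot>\<^bsub>E\<^esub> \<alpha>)))
                (char_map C one\<^sub>C true\<^sub>C k))"
proof -
  interpret is_functor C E F by (rule F)
  interpret artin_gluing C E F one\<^sub>C \<Omega>\<^sub>C true\<^sub>C one\<^sub>E \<Omega>\<^sub>E true\<^sub>E P \<pi>\<^sub>1 \<pi>\<^sub>2 Q q\<^sub>1 q\<^sub>2 i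
    by unfold_locales (fact sub_C sub_E lim_E lex_F prod prod_E eq)+
  note glue_defs = true_G true_top Omega_G one_G j
  show ?thesis
  proof (intro conjI allI impI)
    show "iso E j"
      unfolding j by (rule target.iso_terminal[OF target.terminal F_one_terminal])
    show "\<exists>!u. u \<in> Hom E one\<^sub>E (Dom E i) \<and>
        i \<cdot>\<^bsub>E\<^esub> u = pairing E \<pi>\<^sub>1 \<pi>\<^sub>2 true\<^sub>E (FArr F true\<^sub>C \<cdot>\<^bsub>E\<^esub> j)"
      unfolding j by (rule true\<^sub>T_props(1))
    show "subobject_classifier (gluing C E F) one\<^sub>G \<Omega>\<^sub>G true\<^sub>G"
      unfolding glue_defs by (rule gluing_subobject_classifier)
  next
    fix b :: 'p and \<beta> :: 'b and y :: 'o and a :: 'p and \<alpha> :: 'b and x :: 'o and g :: 'b and k :: 'a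
    let ?m = "GArr (GObj b \<beta> y) (GObj a \<alpha> x) g k"
    assume m: "monic (gluing C E F) ?m"
    then have m_in: "?m \<in> Hom (gluing C E F) (GObj b \<beta> y) (GObj a \<alpha> x)"
      by (simp add: monic_def Hom_def gluing_simps)
    show "monic E g" "monic C k"
      using g_monic[OF m m_in] k_monic[OF m m_in] by simp_all
    show "\<exists>!u. u \<in> Hom E a (Dom E i) \<and>
        i \<cdot>\<^bsub>E\<^esub> u = pairing E \<pi>\<^sub>1 \<pi>\<^sub>2 (char_map E one\<^sub>E true\<^sub>E g)
          (FArr F (char_map C one\<^sub>C true\<^sub>C k) \<cdot>\<^bsub>E\<^esub> \<alpha>)"
      using \<chi>\<beta>_props(1)[OF m m_in] by simp
    show "char_map (gluing C E F) one\<^sub>G true\<^sub>G ?m = GArr (GObj a \<alpha> x) \<Omega>\<^sub>G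
        (induced E i (pairing E \<pi>\<^sub>1 \<pi>\<^sub>2 (char_map E one\<^sub>E true\<^sub>E g)
          (FArr F (char_map C one\<^sub>C true\<^sub>C k) \<cdot>\<^bsub>E\<^esub> \<alpha>)))
        (char_map C one\<^sub>C true\<^sub>C k)"
      unfolding glue_defs using gluing_char_map[OF m m_in] by simp
  qed
qed

end
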